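(* Let $0<r_0<r_1$, $\Omega_1=(r_0,r_1)\times(\theta_{so}-\sigma_0,\theta_+)$, and let $\mathcal A^{(1)},\mathcal A^{(2)},\mathcal A^{(3)},\mathcal Q,\mathcal B,\mathcal B_\pm,\mathcal G,\mathcal M$ be the matrix-valued functions defined in the context. For any $\mathbf f\in L^2(\Omega_1;\mathbb R^2)$ there exists a weak solution $\mathbf u\in L^2(\Omega_1;\mathbb R^2)$ to the problem $$\mathcal K\mathbf u:=2\mathcal A^{(1)}\partial_r\mathbf u+2\mathcal A^{(2)}\partial_\theta\mathbf u+\mathcal A^{(3)}\mathbf u=\mathbf f\ \text{ in }\Omega_1,\qquad \mathcal M\mathbf u=\mathbf 0\ \text{ on }\partial\Omega_1,$$ in the sense that $$\int_{\Omega_1}\mathbf f\cdot\mathbf v\,drd\theta=\int_{\Omega_1}\mathcal K^*\mathbf v\cdot\mathbf u\,drd\theta$$ holds for any $\mathbf v\in C^1(\overline{\Omega_1};\mathbb R^2)$ satisfying $\mathcal M^*\mathbf v=\mathbf 0$ on $\partial\Omega_1$, where $$\mathcal K^*\mathbf v=-\mathcal A^{(1)}\partial_r\mathbf v-\mathcal A^{(2)}\partial_\theta\mathbf v-\partial_r(\mathcal A^{(1)}\mathbf v)-\partial_\theta(\mathcal A^{(2)}\mathbf v)+\mathcal Q^\top\mathbf v,\qquad \mathcal M^*\mathbf v=\mathcal G^\top\mathbf v+\mathcal B\mathbf v.$$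
   Context: Background flow: fix $\gamma>1$, $A_0,B_0>0$, $\theta_{so}\in(0,\frac\pi2)$, $U_{01},U_{02}>0$ with $U_{01}^2+U_{02}^2=\frac{2(\gamma-1)}{\gamma+1}B_0$. On an interval $[\theta_-,\theta_+]$ with $0<\theta_-<\theta_{so}<\theta_+<\frac\pi2$, $(\bar U_1,\bar U_2)$ is the smooth solution of $$\bar U_1'=\bar U_2,\quad \bar U_2'=-\bar U_1-\frac{\bar U_1\sin\theta+\bar U_2\cos\theta}{(1-\bar M_2^2)\sin\theta},\quad c^2(\bar\rho)=A_0\gamma\bar\rho^{\gamma-1}=(\gamma-1)\big(B_0-\tfrac12(\bar U_1^2+\bar U_2^2)\big),$$ with $(\bar U_1,\bar U_2)(\theta_{so})=(U_{01},U_{02})$, where $\bar M_i=\bar U_i/c(\bar\rho)$; the interval is such that on it $\bar U_1,\bar U_2>0$, $1-\bar M_1^2>0$, $1-\bar M_2^2>0$, and $|\bar{\mathbf M}|^2=\bar M_1^2+\bar M_2^2$ is strictly decreasing with $|\bar{\mathbf M}(\theta_{so})|^2=1$. Coefficients (functions of $\theta$): $\bar A_{11}=c^2(\bar\rho)-\bar U_1^2$, $\bar A_{12}=-\bar U_1\bar U_2$, $\bar A_{22}=c^2(\bar\rho)-\bar U_2^2$, $$e_1=2c^2(\bar\rho)-\bar U_2^2+\frac{(\gamma-1)\bar U_1\bar M_2^2(\bar U_1\sin\theta+\bar U_2\cos\theta)}{(1-\bar M_2^2)\sin\theta},$$ $$e_2=(3-\gamma)\bar U_2(\bar U_1+\bar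 U_2\cot\theta)+\frac{(\gamma+1)\bar U_2}{1-\bar M_2^2}(\bar U_1+\bar U_2\cot\theta)+(c^2(\bar\rho)-2\bar U_2^2)\cot\theta,$$ $\bar k_{11}=\frac{1-\bar M_1^2-\bar M_2^2}{(1-\bar M_2^2)^2}$, $\bar k_2=e_2/\bar A_{22}$, $f(\theta)=\exp\int_{\theta_c}^\theta\frac{\bar A_{12}}{\bar A_{22}}d\tau$ for a fixed reference angle $\theta_c\in[\theta_-,\theta_+]$. Functions $l_1,l_2$: fix $d_1(\theta_{so})>0$, put $d_1(\theta)=d_1(\theta_{so})e^{\int_{\theta_{so}}^\theta\bar k_2d\tau}$, $d_*=\max\{\|d_1\|_{L^\infty},4\}$, $d_2(\theta)=d_2(\theta_{so})e^{2\int_{\theta_{so}}^{\theta}\bar k_2d\tau}-2d_*\int_{\theta_{so}}^\theta e^{2\int_s^\theta\bar k_2d\tau}ds$, with $d_2(\theta_{so})>0$ fixed so large that on $[\theta_-,\theta_+]$: $d_2>0$ and $\frac12[(\bar k_{11}d_2)'-\bar k_{11}d_1]\ge2$. Then $l_1=\frac1{f\bar A_{22}}(\frac{f'}{f}d_2-d_1)<0$, $l_2=\frac{d_2}{f\bar A_{22}}>0$. The constant $\sigma_0>0$ (with $\theta_{so}-\sigma_0\ge\theta_-$) is small enough that $K_4:=2\bar A_{12}l_2-\frac{\bar A_{11}l_2^2}{l_1}-\bar A_{22}l_1>0$ on $[\theta_{so}-\sigma_0,\theta_+]$. Matrices, with $\mu_1=3$: $$\mathcal A^{(1)}=r^{\mu_1}\begin{pmatrix}l_1\bar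 A_{11}&l_2\bar A_{11}\\ l_2\bar A_{11}&2\bar A_{12}l_2-\bar A_{22}l_1\end{pmatrix},\quad \mathcal A^{(2)}=r^{\mu_1-1}\begin{pmatrix}2\bar A_{12}l_1-\bar A_{11}l_2&\bar A_{22}l_1\\ \bar A_{22}l_1&\bar A_{22}l_2\end{pmatrix},$$ $$\mathcal A^{(3)}=2r^{\mu_1-1}\begin{pmatrix}l_1e_1&l_1e_2+\bar A_{11}l_2\\ l_2e_1&l_2e_2+2\bar A_{12}l_2-\bar A_{22}l_1\end{pmatrix},\qquad \mathcal Q=\mathcal A^{(3)}-\partial_r\mathcal A^{(1)}-\partial_\theta\mathcal A^{(2)}.$$ On $\partial\Omega_1$ with outer normal $(n_1,n_2)$ in the $(r,\theta)$ plane, $\mathcal B=n_1\mathcal A^{(1)}+n_2\mathcal A^{(2)}=\mathcal B_++\mathcal B_-$, where $$r=r_0:\ \mathcal B_+=-r_0^{\mu_1}\bar A_{11}l_1\begin{pmatrix}1&l_2/l_1\\ l_2/l_1&l_2^2/l_1^2\end{pmatrix},\ \mathcal B_-=-r_0^{\mu_1}\begin{pmatrix}0&0\\0&K_4\end{pmatrix};$$ $$r=r_1:\ \mathcal B_-=r_1^{\mu_1}\bar A_{11}l_1\begin{pmatrix}1&l_2/l_1\\ l_2/l_1&l_2^2/l_1^2\end{pmatrix},\ \mathcal B_+=r_1^{\mu_1}\begin{pmatrix}0&0\\0&K_4\end{pmatrix};$$ $$\theta=\theta_{so}-\sigma_0:\ \mathcal B_-=-r^{\mu_1-1}\bar A_{22}l_2\begin{pmatrix}l_1^2/l_2^2&l_1/l_2\\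 l_1/l_2&1\end{pmatrix},\ \mathcal B_+=-r^{\mu_1-1}\begin{pmatrix}K_4l_1/l_2&0\\0&0\end{pmatrix};$$ $$\theta=\theta_+:\ \mathcal B_+=r^{\mu_1-1}\bar A_{22}l_2\begin{pmatrix}l_1^2/l_2^2&l_1/l_2\\ l_1/l_2&1\end{pmatrix},\ \mathcal B_-=r^{\mu_1-1}\begin{pmatrix}K_4l_1/l_2&0\\0&0\end{pmatrix}.$$ Finally $\mathcal G=\mathcal B_+-\mathcal B_-$ and $\mathcal M=\mathcal G-\mathcal B=-2\mathcal B_-$. (With $\mathbf u=(\partial_r\Psi,\frac1r\partial_\theta\Psi)$, the condition $\mathcal M\mathbf u=0$ means $u_2=0$ at $r=r_0$; $u_1+\frac{l_2}{l_1}u_2=0$ at $r=r_1$ and at $\theta=\theta_{so}-\sigma_0$; $u_1=0$ at $\theta=\theta_+$.) *)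

theory Defs
  imports "HOL-Analysis.Analysis" "HOL-Probability.Essential_Supremum"
begin

section \<open>Background flow\<close>

text \<open>
  All data that are fixed throughout. The angular interval
  \<open>[\<theta>\<^sub>-, \<theta>\<^sub>+]\<close> is \<open>{theta_min..theta_max}\<close>;
  \<open>theta_ref\<close> is the reference angle \<open>\<theta>\<^sub>c\<close>, and \<open>d1_so\<close>, \<open>d2_so\<close> are the
  values of \<open>d\<^sub>1\<close>, \<open>d\<^sub>2\<close> at the sonic angle \<open>theta_so\<close>.
\<close>

record flow =
  gam :: real
  A0 :: real
  B0 :: real
  U01 :: real
  U02 :: real
  theta_so :: real
  theta_min :: real
  theta_max :: real
  theta_ref :: real
  U1 :: "real \<Rightarrow> real"
  U2 :: "real \<Rightarrow> real"
  rho :: "real \<Rightarrow> real"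
  d1_so :: real
  d2_so :: real
  sigma0 :: real

definition c2 :: "flow \<Rightarrow> real \<Rightarrow> real"
  where "c2 D \<theta> = A0 D * gam D * rho D \<theta> powr (gam D - 1)"

definition M1 :: "flow \<Rightarrow> real \<Rightarrow> real"
  where "M1 D \<theta> = U1 D \<theta> / sqrt (c2 D \<theta>)"

definition M2 :: "flow \<Rightarrow> real \<Rightarrow> real"
  where "M2 D \<theta> = U2 D \<theta> / sqrt (c2 D \<theta>)"

abbreviation angles :: "flow \<Rightarrow> real set"
  where "angles D \<equiv> {theta_min D..theta_max D}"

text \<open>
  Derivatives at the end points of the angular interval are one-sided. Smoothness of the
  solution follows from the ODE system, whose right-hand side is smooth where
  \<open>\<rho> > 0\<close> and \<open>M\<^sub>2\<^sup>2 < 1\<close>.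
\<close>

definition background_flow :: "flow \<Rightarrow> bool" where
  "background_flow D \<longleftrightarrow>
     gam D > 1 \<and> A0 D > 0 \<and> B0 D > 0 \<and>
     0 < theta_so D \<and> theta_so D < pi / 2 \<and>
     U01 D > 0 \<and> U02 D > 0 \<and>
     (U01 D)\<^sup>2 + (U02 D)\<^sup>2 = 2 * (gam D - 1) / (gam D + 1) * B0 D \<and>
     0 < theta_min D \<and> theta_min D < theta_so D \<and>
     theta_so D < theta_max D \<and> theta_max D < pi / 2 \<and>
     (\<forall>\<theta>\<in>angles D.
        (U1 D has_real_derivative U2 D \<theta>) (at \<theta> within angles D) \<and>
        (U2 D has_real_derivative
           - U1 D \<theta> - (U1 D \<theta> * sin \<theta> + U2 D \<theta> * cos \<theta>) / ((1 - (M2 D \<theta>)\<^sup>2) * sin \<theta>))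
          (at \<theta> within angles D) \<and>
        rho D \<theta> > 0 \<and>
        c2 D \<theta> = (gam D - 1) * (B0 D - 1 / 2 * ((U1 D \<theta>)\<^sup>2 + (U2 D \<theta>)\<^sup>2)) \<and>
        U1 D \<theta> > 0 \<and> U2 D \<theta> > 0 \<and>
        1 - (M1 D \<theta>)\<^sup>2 > 0 \<and> 1 - (M2 D \<theta>)\<^sup>2 > 0) \<and>
     U1 D (theta_so D) = U01 D \<and> U2 D (theta_so D) = U02 D \<and>
     strict_antimono_on (angles D) (\<lambda>\<theta>. (M1 D \<theta>)\<^sup>2 + (M2 D \<theta>)\<^sup>2) \<and>
     (M1 D (theta_so D))\<^sup>2 + (M2 D (theta_so D))\<^sup>2 = 1"

section \<open>Coefficients and multipliers\<close>

definition A11 :: "flow \<Rightarrow> real \<Rightarrow> real"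
  where "A11 D \<theta> = c2 D \<theta> - (U1 D \<theta>)\<^sup>2"

definition A12 :: "flow \<Rightarrow> real \<Rightarrow> real"
  where "A12 D \<theta> = - U1 D \<theta> * U2 D \<theta>"

definition A22 :: "flow \<Rightarrow> real \<Rightarrow> real"
  where "A22 D \<theta> = c2 D \<theta> - (U2 D \<theta>)\<^sup>2"

definition e1 :: "flow \<Rightarrow> real \<Rightarrow> real" where
  "e1 D \<theta> = 2 * c2 D \<theta> - (U2 D \<theta>)\<^sup>2
     + (gam D - 1) * U1 D \<theta> * (M2 D \<theta>)\<^sup>2 * (U1 D \<theta> * sin \<theta> + U2 D \<theta> * cos \<theta>)
         / ((1 - (M2 D \<theta>)\<^sup>2) * sin \<theta>)"

definition e2 :: "flow \<Rightarrow> real \<Rightarrow> real" where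
  "e2 D \<theta> = (3 - gam D) * U2 D \<theta> * (U1 D \<theta> + U2 D \<theta> * cot \<theta>)
     + (gam D + 1) * U2 D \<theta> / (1 - (M2 D \<theta>)\<^sup>2) * (U1 D \<theta> + U2 D \<theta> * cot \<theta>)
     + (c2 D \<theta> - 2 * (U2 D \<theta>)\<^sup>2) * cot \<theta>"

definition k11 :: "flow \<Rightarrow> real \<Rightarrow> real"
  where "k11 D \<theta> = (1 - (M1 D \<theta>)\<^sup>2 - (M2 D \<theta>)\<^sup>2) / (1 - (M2 D \<theta>)\<^sup>2)\<^sup>2"

definition k2 :: "flow \<Rightarrow> real \<Rightarrow> real"
  where "k2 D \<theta> = e2 D \<theta> / A22 D \<theta>"

text \<open>
  \<open>wt\<close> is the integrating factor \<open>f\<close>. All integrals between angles are oriented, that is,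
  they change sign when the limits are exchanged.
\<close>

definition wt :: "flow \<Rightarrow> real \<Rightarrow> real"
  where "wt D \<theta> = exp (LBINT \<tau>=theta_ref D..\<theta>. A12 D \<tau> / A22 D \<tau>)"

text \<open>Derivative in \<open>\<theta>\<close> along the closed angular interval (one-sided at its end points).\<close>

definition dtheta :: "flow \<Rightarrow> (real \<Rightarrow> real) \<Rightarrow> real \<Rightarrow> real"
  where "dtheta D g \<theta> = vector_derivative g (at \<theta> within angles D)"

definition Linf_norm :: "real set \<Rightarrow> (real \<Rightarrow> real) \<Rightarrow> real"
  where "Linf_norm S g = real_of_ereal (esssup (lebesgue_on S) (\<lambda>x. ereal \<bar>g x\<bar>))"

definition d1 :: "flow \<Rightarrow> real \<Rightarrow> real"
  where "d1 D \<theta> = d1_so D * exp (LBINT \<tau>=theta_so D..\<theta>. k2 D \<tau>)"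

definition d_star :: "flow \<Rightarrow> real"
  where "d_star D = max (Linf_norm (angles D) (d1 D)) 4"

definition d2 :: "flow \<Rightarrow> real \<Rightarrow> real" where
  "d2 D \<theta> = d2_so D * exp (2 * (LBINT \<tau>=theta_so D..\<theta>. k2 D \<tau>))
     - 2 * d_star D * (LBINT s=theta_so D..\<theta>. exp (2 * (LBINT \<tau>=s..\<theta>. k2 D \<tau>)))"

definition l1 :: "flow \<Rightarrow> real \<Rightarrow> real" where
  "l1 D \<theta> = 1 / (wt D \<theta> * A22 D \<theta>) * (dtheta D (wt D) \<theta> / wt D \<theta> * d2 D \<theta> - d1 D \<theta>)"

definition l2 :: "flow \<Rightarrow> real \<Rightarrow> real"
  where "l2 D \<theta> = d2 D \<theta> / (wt D \<theta> * A22 D \<theta>)"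

definition K4 :: "flow \<Rightarrow> real \<Rightarrow> real" where
  "K4 D \<theta> = 2 * A12 D \<theta> * l2 D \<theta> - A11 D \<theta> * (l2 D \<theta>)\<^sup>2 / l1 D \<theta> - A22 D \<theta> * l1 D \<theta>"

text \<open>The choices of the constants \<open>\<theta>\<^sub>c\<close>, \<open>d\<^sub>1(\<theta>\<^sub>s\<^sub>o)\<close>, \<open>d\<^sub>2(\<theta>\<^sub>s\<^sub>o)\<close> and \<open>\<sigma>\<^sub>0\<close>.\<close>

definition multiplier_choice :: "flow \<Rightarrow> bool" where
  "multiplier_choice D \<longleftrightarrow>
     theta_ref D \<in> angles D \<and>
     d1_so D > 0 \<and> d2_so D > 0 \<and>
     (\<forall>\<theta>\<in>angles D. d2 D \<theta> > 0 \<and>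
        1 / 2 * (dtheta D (\<lambda>t. k11 D t * d2 D t) \<theta> - k11 D \<theta> * d1 D \<theta>) \<ge> 2) \<and>
     sigma0 D > 0 \<and> theta_so D - sigma0 D \<ge> theta_min D \<and>
     (\<forall>\<theta>\<in>{theta_so D - sigma0 D..theta_max D}. K4 D \<theta> > 0)"

section \<open>The first order system\<close>

text \<open>Points of the \<open>(r, \<theta>)\<close> plane are pairs.\<close>

definition Omega1 :: "flow \<Rightarrow> real \<Rightarrow> real \<Rightarrow> (real \<times> real) set"
  where "Omega1 D r0 r1 = {r0<..<r1} \<times> {theta_so D - sigma0 D<..<theta_max D}"

abbreviation mu1 :: nat
  where "mu1 \<equiv> 3"

definition mat2 :: "real \<Rightarrow> real \<Rightarrow> real \<Rightarrow> real \<Rightarrow> real^2^2"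
  where "mat2 a b c d = vector [vector [a, b], vector [c, d]]"

definition calA1 :: "flow \<Rightarrow> real \<times> real \<Rightarrow> real^2^2" where
  "calA1 D = (\<lambda>(r, \<theta>). r ^ mu1 *\<^sub>R
     mat2 (l1 D \<theta> * A11 D \<theta>) (l2 D \<theta> * A11 D \<theta>)
          (l2 D \<theta> * A11 D \<theta>) (2 * A12 D \<theta> * l2 D \<theta> - A22 D \<theta> * l1 D \<theta>))"

definition calA2 :: "flow \<Rightarrow> real \<times> real \<Rightarrow> real^2^2" where
  "calA2 D = (\<lambda>(r, \<theta>). r ^ (mu1 - 1) *\<^sub>R
     mat2 (2 * A12 D \<theta> * l1 D \<theta> - A11 D \<theta> * l2 D \<theta>) (A22 D \<theta> * l1 D \<theta>)
          (A22 D \<theta> * l1 D \<theta>) (A22 D \<theta> * l2 D \<theta>))"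

definition calA3 :: "flow \<Rightarrow> real \<times> real \<Rightarrow> real^2^2" where
  "calA3 D = (\<lambda>(r, \<theta>). (2 * r ^ (mu1 - 1)) *\<^sub>R
     mat2 (l1 D \<theta> * e1 D \<theta>) (l1 D \<theta> * e2 D \<theta> + A11 D \<theta> * l2 D \<theta>)
          (l2 D \<theta> * e1 D \<theta>)
          (l2 D \<theta> * e2 D \<theta> + 2 * A12 D \<theta> * l2 D \<theta> - A22 D \<theta> * l1 D \<theta>))"

definition partial_r :: "(real \<times> real \<Rightarrow> 'a::real_normed_vector) \<Rightarrow> real \<times> real \<Rightarrow> 'a"
  where "partial_r F = (\<lambda>(r, \<theta>). vector_derivative (\<lambda>s. F (s, \<theta>)) (at r))"

definition partial_theta :: "(real \<times> real \<Rightarrow> 'a::real_normed_vector) \<Rightarrow> real \<times> real \<Rightarrow> 'a"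
  where "partial_theta F = (\<lambda>(r, \<theta>). vector_derivative (\<lambda>t. F (r, t)) (at \<theta>))"

definition calQ :: "flow \<Rightarrow> real \<times> real \<Rightarrow> real^2^2"
  where "calQ D x = calA3 D x - partial_r (calA1 D) x - partial_theta (calA2 D) x"

definition K_op :: "flow \<Rightarrow> (real \<times> real \<Rightarrow> real^2) \<Rightarrow> real \<times> real \<Rightarrow> real^2" where
  "K_op D u x = 2 *\<^sub>R (calA1 D x *v partial_r u x) + 2 *\<^sub>R (calA2 D x *v partial_theta u x)
     + calA3 D x *v u x"

definition K_adj :: "flow \<Rightarrow> (real \<times> real \<Rightarrow> real^2) \<Rightarrow> real \<times> real \<Rightarrow> real^2" where
  "K_adj D v x = - (calA1 D x *v partial_r v x) - calA2 D x *v partial_theta v x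
     - partial_r (\<lambda>y. calA1 D y *v v y) x - partial_theta (\<lambda>y. calA2 D y *v v y) x
     + transpose (calQ D x) *v v x"

section \<open>Boundary matrices\<close>

text \<open>
  The sides of the rectangle are taken without the corners, where the outer normal is not
  defined. For test functions that are continuous up to the boundary this makes no difference,
  since a boundary condition on an open side extends to its end points.
\<close>

datatype side = R_inner | R_outer | Theta_lower | Theta_upper

fun edge :: "flow \<Rightarrow> real \<Rightarrow> real \<Rightarrow> side \<Rightarrow> (real \<times> real) set" where
  "edge D r0 r1 R_inner = {r0} \<times> {theta_so D - sigma0 D<..<theta_max D}"
| "edge D r0 r1 R_outer = {r1} \<times> {theta_so D - sigma0 D<..<theta_max D}"
| "edge D r0 r1 Theta_lower = {r0<..<r1} \<times> {theta_so D - sigma0 D}"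
| "edge D r0 r1 Theta_upper = {r0<..<r1} \<times> {theta_max D}"

fun normal :: "side \<Rightarrow> real \<times> real" where
  "normal R_inner = (-1, 0)"
| "normal R_outer = (1, 0)"
| "normal Theta_lower = (0, -1)"
| "normal Theta_upper = (0, 1)"

definition calB :: "flow \<Rightarrow> side \<Rightarrow> real \<times> real \<Rightarrow> real^2^2"
  where "calB D s x = fst (normal s) *\<^sub>R calA1 D x + snd (normal s) *\<^sub>R calA2 D x"

fun B_plus :: "flow \<Rightarrow> side \<Rightarrow> real \<times> real \<Rightarrow> real^2^2" where
  "B_plus D R_inner (r, \<theta>) = (- (r ^ mu1) * A11 D \<theta> * l1 D \<theta>) *\<^sub>R
     mat2 1 (l2 D \<theta> / l1 D \<theta>) (l2 D \<theta> / l1 D \<theta>) ((l2 D \<theta>)\<^sup>2 / (l1 D \<theta>)\<^sup>2)"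
| "B_plus D R_outer (r, \<theta>) = r ^ mu1 *\<^sub>R mat2 0 0 0 (K4 D \<theta>)"
| "B_plus D Theta_lower (r, \<theta>) =
     (- (r ^ (mu1 - 1))) *\<^sub>R mat2 (K4 D \<theta> * l1 D \<theta> / l2 D \<theta>) 0 0 0"
| "B_plus D Theta_upper (r, \<theta>) = (r ^ (mu1 - 1) * A22 D \<theta> * l2 D \<theta>) *\<^sub>R
     mat2 ((l1 D \<theta>)\<^sup>2 / (l2 D \<theta>)\<^sup>2) (l1 D \<theta> / l2 D \<theta>) (l1 D \<theta> / l2 D \<theta>) 1"

fun B_minus :: "flow \<Rightarrow> side \<Rightarrow> real \<times> real \<Rightarrow> real^2^2" where
  "B_minus D R_inner (r, \<theta>) = (- (r ^ mu1)) *\<^sub>R mat2 0 0 0 (K4 D \<theta>)"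
| "B_minus D R_outer (r, \<theta>) = (r ^ mu1 * A11 D \<theta> * l1 D \<theta>) *\<^sub>R
     mat2 1 (l2 D \<theta> / l1 D \<theta>) (l2 D \<theta> / l1 D \<theta>) ((l2 D \<theta>)\<^sup>2 / (l1 D \<theta>)\<^sup>2)"
| "B_minus D Theta_lower (r, \<theta>) = (- (r ^ (mu1 - 1)) * A22 D \<theta> * l2 D \<theta>) *\<^sub>R
     mat2 ((l1 D \<theta>)\<^sup>2 / (l2 D \<theta>)\<^sup>2) (l1 D \<theta> / l2 D \<theta>) (l1 D \<theta> / l2 D \<theta>) 1"
| "B_minus D Theta_upper (r, \<theta>) =
     r ^ (mu1 - 1) *\<^sub>R mat2 (K4 D \<theta> * l1 D \<theta> / l2 D \<theta>) 0 0 0"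

definition calG :: "flow \<Rightarrow> side \<Rightarrow> real \<times> real \<Rightarrow> real^2^2"
  where "calG D s x = B_plus D s x - B_minus D s x"

definition calM :: "flow \<Rightarrow> side \<Rightarrow> real \<times> real \<Rightarrow> real^2^2"
  where "calM D s x = calG D s x - calB D s x"

definition M_adj :: "flow \<Rightarrow> (real \<times> real \<Rightarrow> real^2) \<Rightarrow> side \<Rightarrow> real \<times> real \<Rightarrow> real^2"
  where "M_adj D v s x = transpose (calG D s x) *v v x + calB D s x *v v x"

lemma calB_split:
  assumes "l1 D (snd x) \<noteq> 0" "l2 D (snd x) \<noteq> 0"
  shows "calB D s x = B_plus D s x + B_minus D s x"
  using assms
  by (cases x; cases s)
     (simp_all add: calB_def calA1_def calA2_def mat2_def K4_def vec_eq_iff forall_2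
        field_simps power2_eq_square)

lemma calM_eq:
  assumes "l1 D (snd x) \<noteq> 0" "l2 D (snd x) \<noteq> 0"
  shows "calM D s x = (-2) *\<^sub>R B_minus D s x"
  using calB_split[OF assms, of s]
  by (simp add: calM_def calG_def vec_eq_iff)

section \<open>Weak solutions\<close>

definition L2_on :: "(real \<times> real) set \<Rightarrow> (real \<times> real \<Rightarrow> real^2) \<Rightarrow> bool" where
  "L2_on S f \<longleftrightarrow> f \<in> borel_measurable (lebesgue_on S) \<and>
     integrable (lebesgue_on S) (\<lambda>x. (norm (f x))\<^sup>2)"

text \<open>
  To be used on closures of convex open sets, where it agrees with the requirement that \<open>v\<close> and
  its first partial derivatives extend continuously from the interior to the boundary.
\<close>

definition C1_on :: "(real \<times> real) set \<Rightarrow> (real \<times> real \<Rightarrow> real^2) \<Rightarrow> bool" where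
  "C1_on S v \<longleftrightarrow> (\<exists>v' :: real \<times> real \<Rightarrow> (real \<times> real) \<Rightarrow>\<^sub>L (real^2).
     continuous_on S v' \<and>
     (\<forall>x\<in>S. (v has_derivative blinfun_apply (v' x)) (at x within S)))"

text \<open>
  \<open>u\<close> is a weak solution of \<open>K_op D u = f\<close> in \<open>Omega1 D r0 r1\<close> with \<open>calM D s x *v u x = 0\<close> on
  every side \<open>s\<close>.
\<close>

definition weak_solution ::
  "flow \<Rightarrow> real \<Rightarrow> real \<Rightarrow> (real \<times> real \<Rightarrow> real^2) \<Rightarrow> (real \<times> real \<Rightarrow> real^2) \<Rightarrow> bool" where
  "weak_solution D r0 r1 f u \<longleftrightarrow> L2_on (Omega1 D r0 r1) u \<and>
     (\<forall>v. C1_on (closure (Omega1 D r0 r1)) v \<longrightarrow>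
          (\<forall>s. \<forall>x\<in>edge D r0 r1 s. M_adj D v s x = 0) \<longrightarrow>
          (LINT x|lebesgue_on (Omega1 D r0 r1). f x \<bullet> v x) =
          (LINT x|lebesgue_on (Omega1 D r0 r1). K_adj D v x \<bullet> u x))"

end

theory Submission
  imports Defs
begin

text \<open>
  The proof is Friedrichs' theory of positive symmetric systems: an energy estimate for the
  adjoint problem, followed by the Riesz representation.

  Let \<open>v\<close> be a test function. Since the matrices \<open>\<A>\<^sup>(\<^sup>1\<^sup>)\<close> and \<open>\<A>\<^sup>(\<^sup>2\<^sup>)\<close> are symmetric,
  \<open>K_adj v \<bullet> v = - \<partial>\<^sub>r (\<A>\<^sup>(\<^sup>1\<^sup>) v \<bullet> v) - \<partial>\<^sub>\<theta> (\<A>\<^sup>(\<^sup>2\<^sup>) v \<bullet> v) + \<Q> v \<bullet> v\<close>.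
  Integrated over the rectangle, the first two terms give minus the boundary integral of
  \<open>\<B> v \<bullet> v\<close>. On the boundary \<open>\<M>\<^sup>* v = 2 \<B>\<^sub>+ v\<close>, so that the adjoint boundary condition leaves
  \<open>\<B> v \<bullet> v = \<B>\<^sub>- v \<bullet> v\<close>, which is nonpositive because \<open>l\<^sub>1 < 0 < l\<^sub>2\<close> and \<open>K\<^sub>4 > 0\<close>
  (\<open>boundary_dissipative\<close>).

  The heart of the matter is that \<open>\<Q>\<close> is uniformly positive (\<open>NQ_coercive\<close>). Put
  \<open>a = A\<^sub>1\<^sub>1 / A\<^sub>2\<^sub>2\<close> and \<open>b = A\<^sub>1\<^sub>2 / A\<^sub>2\<^sub>2\<close>, so that \<open>k\<^sub>1\<^sub>1 = a - b\<^sup>2\<close>. The equations of the background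
  flow imply \<open>b' = (e\<^sub>1 - 2 A\<^sub>1\<^sub>1) / A\<^sub>2\<^sub>2 - b k\<^sub>2 + b\<^sup>2\<close> (\<open>b_deriv\<close>). With this and the equations
  \<open>d\<^sub>1' = k\<^sub>2 d\<^sub>1\<close>, \<open>d\<^sub>2' = 2 k\<^sub>2 d\<^sub>2 - 2 d\<^sub>*\<close>, \<open>wt' = b wt\<close> of the multipliers all terms of
  \<open>\<Q>\<close> combine to
  \<open>r\<^sup>-\<^sup>2 wt \<Q> w \<bullet> w = (2 d\<^sub>* - d\<^sub>1) (w\<^sub>2 + b w\<^sub>1)\<^sup>2 + ((k\<^sub>1\<^sub>1 d\<^sub>2)' - k\<^sub>1\<^sub>1 d\<^sub>1) w\<^sub>1\<^sup>2\<close>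
  (\<open>NQ_quadratic_form\<close>), and the choice of \<open>d\<^sub>*\<close> and \<open>d\<^sub>2\<close> makes both coefficients at least 4.

  Altogether \<open>c \<parallel>v\<parallel>\<^sup>2 \<le> \<langle>K_adj v, v\<rangle>\<close> and hence \<open>c \<parallel>v\<parallel> \<le> \<parallel>K_adj v\<parallel>\<close> in \<open>L\<^sup>2\<close>
  (\<open>energy_estimate\<close>). So \<open>\<langle>f, v\<rangle>\<close> is a bounded linear functional of \<open>K_adj v\<close>, and it is
  represented by some \<open>u\<close> in \<open>L\<^sup>2\<close> (\<open>Riesz_L2\<close>), which is the weak solution.
\<close>

section \<open>Square-integrable functions and the Riesz representation\<close>

definition square_integrable :: "'a measure \<Rightarrow> ('a \<Rightarrow> 'b::euclidean_space) \<Rightarrow> bool" where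
  "square_integrable M f \<longleftrightarrow> f \<in> borel_measurable M \<and> integrable M (\<lambda>x. (norm (f x))\<^sup>2)"

lemma square_integrable_measurable [measurable_dest]:
  "square_integrable M f \<Longrightarrow> f \<in> borel_measurable M"
  by (simp add: square_integrable_def)

lemma square_integrable_integrable_norm:
  "square_integrable M f \<Longrightarrow> integrable M (\<lambda>x. (norm (f x))\<^sup>2)"
  by (simp add: square_integrable_def)

lemma square_integrable_integrable_inner:
  assumes f: "square_integrable M f" and g: "square_integrable M g"
  shows "integrable M (\<lambda>x. f x \<bullet> g x)"
proof (rule Bochner_Integration.integrable_bound)
  show "integrable M (\<lambda>x. (norm (f x))\<^sup>2 + (norm (g x))\<^sup>2)"
    using f g by (simp add: square_integrable_def)
  show "(\<lambda>x. f x \<bullet> g x) \<in> borel_measurable M"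
    using f g unfolding square_integrable_def by (auto intro: borel_measurable_inner)
  have "norm (f x \<bullet> g x) \<le> norm ((norm (f x))\<^sup>2 + (norm (g x))\<^sup>2)" for x
  proof -
    have "norm (f x \<bullet> g x) \<le> norm (f x) * norm (g x)"
      by (simp add: Cauchy_Schwarz_ineq2)
    also have "\<dots> \<le> (norm (f x))\<^sup>2 + (norm (g x))\<^sup>2"
      using sum_squares_bound[of "norm (f x)" "norm (g x)"]
        mult_nonneg_nonneg[OF norm_ge_zero[of "f x"] norm_ge_zero[of "g x"]] by linarith
    finally show ?thesis by simp
  qed
  then show "AE x in M. norm (f x \<bullet> g x) \<le> norm ((norm (f x))\<^sup>2 + (norm (g x))\<^sup>2)"
    by simp
qed

lemma square_integrable_cong:
  assumes "square_integrable M f" and "\<And>x. x \<in> space M \<Longrightarrow> f x = g x"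
  shows "square_integrable M g"
proof -
  have "integrable M (\<lambda>x. (norm (g x))\<^sup>2) \<longleftrightarrow> integrable M (\<lambda>x. (norm (f x))\<^sup>2)"
    by (rule Bochner_Integration.integrable_cong) (simp_all add: assms)
  moreover have "g \<in> borel_measurable M \<longleftrightarrow> f \<in> borel_measurable M"
    by (rule measurable_cong) (simp add: assms)
  ultimately show ?thesis using assms(1) by (simp add: square_integrable_def)
qed

lemma norm_lincomb_squared:
  fixes a b :: real and v w :: "'b::real_inner"
  shows "(norm (a *\<^sub>R v + b *\<^sub>R w))\<^sup>2 =
    a\<^sup>2 * (norm v)\<^sup>2 + 2 * a * b * (v \<bullet> w) + b\<^sup>2 * (norm w)\<^sup>2"
  unfolding power2_norm_eq_inner
  by (simp add: inner_add_left inner_add_right inner_commute power2_eq_square algebra_simps)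

lemma square_integrable_lincomb:
  assumes f: "square_integrable M f" and g: "square_integrable M g"
  shows "square_integrable M (\<lambda>x. a *\<^sub>R f x + b *\<^sub>R g x)"
  using assms square_integrable_integrable_inner[OF f g]
  unfolding square_integrable_def norm_lincomb_squared by auto

lemma integral_norm_lincomb_squared:
  assumes f: "square_integrable M f" and g: "square_integrable M g"
  shows "(\<integral>x. (norm (a *\<^sub>R f x + b *\<^sub>R g x))\<^sup>2 \<partial>M) =
    a\<^sup>2 * (\<integral>x. (norm (f x))\<^sup>2 \<partial>M) + 2 * a * b * (\<integral>x. f x \<bullet> g x \<partial>M)
      + b\<^sup>2 * (\<integral>x. (norm (g x))\<^sup>2 \<partial>M)"
  using square_integrable_integrable_inner[OF f g] square_integrable_integrable_norm[OF f]
    square_integrable_integrable_norm[OF g]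
  unfolding norm_lincomb_squared by simp

text \<open>
  The discriminant criterion. It yields the Cauchy--Schwarz inequality and, with a small constant
  term \<open>e\<close>, the first variation of a quadratic functional at an almost minimal point.
\<close>

lemma discriminant_bound:
  fixes e p q :: real
  assumes "\<And>t. 0 \<le> e + 2 * t * p + t\<^sup>2 * q" and "0 \<le> q" "0 \<le> e"
  shows "p\<^sup>2 \<le> e * q"
proof (cases "q = 0")
  case True
  have "p = 0"
  proof (rule ccontr)
    assume "p \<noteq> 0"
    with assms(1)[of "- (e + 1) / (2 * p)"] True show False by (simp add: field_simps)
  qed
  then show ?thesis using True by simp
next
  case False
  with assms have "q > 0" by simp
  have "0 \<le> e + 2 * (- p / q) * p + (- p / q)\<^sup>2 * q" by (rule assms)
  also have "\<dots> = e - p\<^sup>2 / q" using False by (simp add: field_simps power2_eq_square)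
  finally show ?thesis using \<open>q > 0\<close> by (simp add: field_simps)
qed

lemma integral_Cauchy_Schwarz:
  assumes f: "square_integrable M f" and g: "square_integrable M g"
  shows "(\<integral>x. f x \<bullet> g x \<partial>M)\<^sup>2 \<le>
    (\<integral>x. (norm (f x))\<^sup>2 \<partial>M) * (\<integral>x. (norm (g x))\<^sup>2 \<partial>M)"
proof (rule discriminant_bound)
  fix t :: real
  have "0 \<le> (\<integral>x. (norm (1 *\<^sub>R f x + t *\<^sub>R g x))\<^sup>2 \<partial>M)" by simp
  also have "\<dots> = (\<integral>x. (norm (f x))\<^sup>2 \<partial>M) + 2 * t * (\<integral>x. f x \<bullet> g x \<partial>M)
      + t\<^sup>2 * (\<integral>x. (norm (g x))\<^sup>2 \<partial>M)"
    unfolding integral_norm_lincomb_squared[OF f g] by simp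
  finally show "0 \<le> \<dots>" .
qed simp_all

text \<open>
  Completeness of \<open>L\<^sup>2\<close> over an arbitrary measure, for sequences that converge geometrically.
  An increment of size \<open>t\<close> satisfies \<open>t \<le> 2\<^sup>-\<^sup>n + 2\<^sup>n t\<^sup>2\<close>, and the integrals of the terms \<open>2\<^sup>n t\<^sup>2\<close>
  have a finite sum because those of \<open>t\<^sup>2\<close> are at most \<open>4\<^sup>-\<^sup>n\<close>. So the increments are summable almost
  everywhere, and Fatou's lemma controls the distance to the pointwise limit.
\<close>

lemma fast_Cauchy_L2_limit:
  fixes w :: "nat \<Rightarrow> 'a \<Rightarrow> 'b::euclidean_space"
  assumes w: "\<And>n. square_integrable M (w n)"
    and fast: "\<And>n k. (\<integral>x. (norm (w k x - w n x))\<^sup>2 \<partial>M) \<le> (1/4) ^ min n k"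
  shows "\<exists>u. square_integrable M u \<and> (\<lambda>n. \<integral>x. (norm (w n x - u x))\<^sup>2 \<partial>M) \<longlonglongrightarrow> 0"
proof -
  note [measurable] = square_integrable_measurable[OF w]
  have diff: "square_integrable M (\<lambda>x. f x - g x)"
    if "square_integrable M f" "square_integrable M g" for f g :: "'a \<Rightarrow> 'b"
    using square_integrable_lincomb[OF that, of 1 "-1"] by simp
  define g where "g n x = 2 ^ n * (norm (w (Suc n) x - w n x))\<^sup>2" for n x
  have g_meas [measurable]: "g n \<in> borel_measurable M" for n
    unfolding g_def by measurable
  have g_nonneg: "0 \<le> g n x" for n x by (simp add: g_def)
  have g_int: "integrable M (g n)" for n
    unfolding g_def using square_integrable_integrable_norm[OF diff[OF w w]] by simp
  have g_le: "(\<integral>x. g n x \<partial>M) \<le> (1/2) ^ n" for n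
  proof -
    have "(\<integral>x. g n x \<partial>M) = 2 ^ n * (\<integral>x. (norm (w (Suc n) x - w n x))\<^sup>2 \<partial>M)"
      by (simp add: g_def)
    also have "\<dots> \<le> 2 ^ n * (1/4) ^ n"
      using fast[where n=n and k="Suc n"] by (intro mult_left_mono) auto
    also have "\<dots> = (1/2) ^ n" by (simp add: power_mult_distrib[symmetric])
    finally show ?thesis .
  qed
  have "(\<integral>\<^sup>+x. (\<Sum>n. ennreal (g n x)) \<partial>M) = (\<Sum>n. \<integral>\<^sup>+x. ennreal (g n x) \<partial>M)"
    by (rule nn_integral_suminf) simp
  also have "\<dots> \<le> (\<Sum>n. ennreal ((1/2) ^ n))"
    by (intro suminf_le)
       (auto simp: nn_integral_eq_integral[OF g_int] g_nonneg intro!: ennreal_leI g_le)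
  also have "\<dots> < \<infinity>"
    by (subst suminf_ennreal2) auto
  finally have "AE x in M. (\<Sum>n. ennreal (g n x)) \<noteq> \<infinity>"
    by (intro nn_integral_PInf_AE) auto
  then have conv: "AE x in M. convergent (\<lambda>n. w n x)"
  proof eventually_elim
    case (elim x)
    have "summable (\<lambda>n. g n x)"
      using elim g_nonneg by (intro summable_suminf_not_top) auto
    then have sm: "summable (\<lambda>n. (1/2) ^ n + g n x)"
      by (intro summable_add summable_geometric) auto
    have "norm (w (Suc n) x - w n x) \<le> (1/2) ^ n + g n x" for n
    proof -
      let ?t = "norm (w (Suc n) x - w n x)"
      let ?s = "2 ^ n * ?t"
      have "2 * ?s \<le> 1 + ?s\<^sup>2" using sum_squares_bound[of 1 ?s] by simp
      moreover have "0 \<le> ?s" by simp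
      ultimately have "?s \<le> 1 + ?s\<^sup>2" by linarith
      also have "\<dots> = 2 ^ n * ((1/2) ^ n + 2 ^ n * ?t\<^sup>2)"
        unfolding distrib_left power_one_over power_mult_distrib
        by (simp add: power2_eq_square)
      finally show ?thesis unfolding g_def
        by (rule mult_left_le_imp_le[where c="2 ^ n"]) simp
    qed
    then have "summable (\<lambda>n. w (Suc n) x - w n x)"
      by (rule summable_comparison_test'[OF sm, where N=0])
    then have "convergent (\<lambda>n. \<Sum>i<n. w (Suc i) x - w i x)"
      by (simp add: summable_iff_convergent)
    then have "convergent (\<lambda>n. w n x - w 0 x)"
      using sum_lessThan_telescope[of "\<lambda>n. w n x"] by simp
    from convergent_add[OF this convergent_const[of "w 0 x"]] show ?case by simp
  qed
  define u where "u x = lim (\<lambda>n. w n x)" for x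
  have u_meas [measurable]: "u \<in> borel_measurable M"
    unfolding u_def by measurable
  have lim: "AE x in M. (\<lambda>n. w n x) \<longlonglongrightarrow> u x"
    using conv by eventually_elim (simp add: u_def convergent_LIMSEQ_iff)
  have dist: "(\<integral>\<^sup>+x. ennreal ((norm (u x - w n x))\<^sup>2) \<partial>M) \<le> ennreal ((1/4) ^ n)" for n
  proof -
    have "(\<integral>\<^sup>+x. ennreal ((norm (u x - w n x))\<^sup>2) \<partial>M)
        = (\<integral>\<^sup>+x. liminf (\<lambda>k. ennreal ((norm (w k x - w n x))\<^sup>2)) \<partial>M)"
    proof (rule nn_integral_cong_AE)
      show "AE x in M. ennreal ((norm (u x - w n x))\<^sup>2)
          = liminf (\<lambda>k. ennreal ((norm (w k x - w n x))\<^sup>2))"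
        using lim
      proof eventually_elim
        case (elim x)
        have "(\<lambda>k. ennreal ((norm (w k x - w n x))\<^sup>2)) \<longlonglongrightarrow> ennreal ((norm (u x - w n x))\<^sup>2)"
          by (intro tendsto_intros elim)
        then show ?case by (intro lim_imp_Liminf[symmetric]) auto
      qed
    qed
    also have "\<dots> \<le> liminf (\<lambda>k. \<integral>\<^sup>+x. ennreal ((norm (w k x - w n x))\<^sup>2) \<partial>M)"
      by (rule nn_integral_liminf) measurable
    also have "\<dots> \<le> limsup (\<lambda>k. \<integral>\<^sup>+x. ennreal ((norm (w k x - w n x))\<^sup>2) \<partial>M)"
      by (rule Liminf_le_Limsup) simp
    also have "\<dots> \<le> ennreal ((1/4) ^ n)"
    proof (rule Limsup_bounded)
      show "\<forall>\<^sub>F k in sequentially.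
          (\<integral>\<^sup>+x. ennreal ((norm (w k x - w n x))\<^sup>2) \<partial>M) \<le> ennreal ((1/4) ^ n)"
        using eventually_ge_at_top[of n]
      proof eventually_elim
        case (elim k)
        then show ?case
          using fast[of k n]
          by (subst nn_integral_eq_integral)
             (auto intro!: ennreal_leI square_integrable_integrable_norm[OF diff[OF w w]]
               simp: min_def)
      qed
    qed
    finally show ?thesis .
  qed
  have duw: "square_integrable M (\<lambda>x. u x - w n x)" for n
    unfolding square_integrable_def
  proof (intro conjI integrableI_bounded)
    show "(\<integral>\<^sup>+ x. ennreal (norm ((norm (u x - w n x))\<^sup>2)) \<partial>M) < \<infinity>"
      using dist[of n] by (simp add: order_le_less_trans)
  qed measurable
  have "square_integrable M u"
    using square_integrable_lincomb[OF duw[of 0] w[of 0], of 1 1] by simp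
  moreover have "(\<lambda>n. \<integral>x. (norm (w n x - u x))\<^sup>2 \<partial>M) \<longlonglongrightarrow> 0"
  proof (rule tendsto_sandwich[OF _ _ tendsto_const])
    show "(\<lambda>n. (1/4::real) ^ n) \<longlonglongrightarrow> 0" by (intro LIMSEQ_realpow_zero) auto
    have "(\<integral>x. (norm (w n x - u x))\<^sup>2 \<partial>M) \<le> (1/4) ^ n" for n
      using dist[of n] square_integrable_integrable_norm[OF duw[of n]]
      by (simp add: nn_integral_eq_integral norm_minus_commute)
    then show "\<forall>\<^sub>F n in sequentially. (\<integral>x. (norm (w n x - u x))\<^sup>2 \<partial>M) \<le> (1/4) ^ n"
      by simp
  qed simp
  ultimately show ?thesis by blast
qed

lemma tendsto_zero_of_square_le:
  fixes x y :: "nat \<Rightarrow> real"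
  assumes le: "\<And>n. (x n)\<^sup>2 \<le> y n * c" and y: "y \<longlonglongrightarrow> 0"
  shows "x \<longlonglongrightarrow> 0"
proof -
  have "(\<lambda>n. y n * c) \<longlonglongrightarrow> 0" using tendsto_mult_left_zero[OF y] by simp
  then have "(\<lambda>n. (x n)\<^sup>2) \<longlonglongrightarrow> 0"
    by (rule tendsto_sandwich[OF _ _ tendsto_const, rotated 2]) (use le in auto)
  from tendsto_real_sqrt[OF this] show ?thesis by (simp add: tendsto_rabs_zero_iff)
qed

text \<open>
  The functional \<open>L\<close> is represented on the range of \<open>T\<close> by the \<open>L\<^sup>2\<close> limit of \<open>T v\<^sub>n\<close> along a
  minimising sequence of \<open>J v = \<parallel>T v\<parallel>\<^sup>2 - 2 L v\<close>. The parallelogram identity makes the sequence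
  Cauchy, and the first variation of \<open>J\<close> at the minimum is the representation. Linearity of \<open>T\<close> is
  asked for in the weak form of an existence statement on \<open>V\<close> because a differential operator is
  linear only on those functions, and at those points, where the derivatives exist.
\<close>

lemma Riesz_L2:
  fixes T :: "'v \<Rightarrow> 'a \<Rightarrow> 'b::euclidean_space" and L :: "'v \<Rightarrow> real"
  assumes ne: "V \<noteq> {}"
    and T: "\<And>v. v \<in> V \<Longrightarrow> square_integrable M (T v)"
    and C: "0 \<le> C"
    and lin: "\<And>v w a b. v \<in> V \<Longrightarrow> w \<in> V \<Longrightarrow>
      \<exists>z\<in>V. (\<forall>x\<in>space M. T z x = a *\<^sub>R T v x + b *\<^sub>R T w x) \<and> L z = a * L v + b * L w"
    and bound: "\<And>v. v \<in> V \<Longrightarrow> (L v)\<^sup>2 \<le> C * (\<integral>x. (norm (T v x))\<^sup>2 \<partial>M)"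
  shows "\<exists>u. square_integrable M u \<and> (\<forall>v\<in>V. (\<integral>x. T v x \<bullet> u x \<partial>M) = L v)"
proof -
  define N where "N v = (\<integral>x. (norm (T v x))\<^sup>2 \<partial>M)" for v
  define ip where "ip v w = (\<integral>x. T v x \<bullet> T w x \<partial>M)" for v w
  define J where "J v = N v - 2 * L v" for v
  have N_nonneg: "0 \<le> N v" for v by (simp add: N_def)
  have N_comb: "\<exists>z\<in>V. N z = a\<^sup>2 * N v + 2 * a * b * ip v w + b\<^sup>2 * N w
      \<and> L z = a * L v + b * L w" if vw: "v \<in> V" "w \<in> V" for v w a b
  proof -
    obtain z where z: "z \<in> V" "\<forall>x\<in>space M. T z x = a *\<^sub>R T v x + b *\<^sub>R T w x"
      "L z = a * L v + b * L w" using lin[OF vw] by blast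
    have "N z = (\<integral>x. (norm (a *\<^sub>R T v x + b *\<^sub>R T w x))\<^sup>2 \<partial>M)"
      unfolding N_def using z by (intro Bochner_Integration.integral_cong) auto
    also have "\<dots> = a\<^sup>2 * N v + 2 * a * b * ip v w + b\<^sup>2 * N w"
      unfolding N_def ip_def by (rule integral_norm_lincomb_squared[OF T[OF vw(1)] T[OF vw(2)]])
    finally show ?thesis using z by blast
  qed
  have lower: "- C \<le> J v" if "v \<in> V" for v
  proof -
    have "(L v)\<^sup>2 \<le> C * N v" using bound[OF that] by (simp add: N_def)
    \<comment> \<open>\<open>4 C N \<le> (N + C)\<^sup>2\<close>\<close>
    then have "(2 * L v)\<^sup>2 \<le> (N v + C)\<^sup>2"
      using zero_le_power2[of "N v - C"] by (simp add: power2_eq_square algebra_simps)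
    then have "2 * L v \<le> N v + C"
      by (rule power2_le_imp_le) (use C N_nonneg in simp)
    then show ?thesis by (simp add: J_def)
  qed
  define m where "m = Inf (J ` V)"
  have bdd: "bdd_below (J ` V)" using lower by (auto intro!: bdd_belowI)
  have m_le: "m \<le> J v" if "v \<in> V" for v
    unfolding m_def using bdd that by (intro cInf_lower) auto
  \<comment> \<open>The parallelogram identity turns the errors \<open>\<epsilon>\<^sub>k\<close>, \<open>\<epsilon>\<^sub>n\<close> of two members of the sequence into the
  squared distance \<open>2 (\<epsilon>\<^sub>k + \<epsilon>\<^sub>n)\<close>; hence the extra factor \<open>1/4\<close>.\<close>
  have "\<exists>v\<in>V. J v < m + (1/4) ^ Suc n" for n
    using cInf_lessD[of "J ` V" "m + (1/4) ^ Suc n"] ne by (auto simp: m_def)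
  then obtain v where v: "\<And>n. v n \<in> V" and Jv: "\<And>n. J (v n) < m + (1/4) ^ Suc n"
    by metis
  have fast: "(\<integral>x. (norm (T (v k) x - T (v n) x))\<^sup>2 \<partial>M) \<le> (1/4) ^ min n k" for n k
  proof -
    obtain z where z: "z \<in> V"
        "N z = (1/2)\<^sup>2 * N (v k) + 2 * (1/2) * (1/2) * ip (v k) (v n) + (1/2)\<^sup>2 * N (v n)"
        "L z = 1/2 * L (v k) + 1/2 * L (v n)"
      using N_comb[OF v v, where a="1/2" and b="1/2"] by blast
    have "(\<integral>x. (norm (T (v k) x - T (v n) x))\<^sup>2 \<partial>M)
        = (\<integral>x. (norm (1 *\<^sub>R T (v k) x + (-1) *\<^sub>R T (v n) x))\<^sup>2 \<partial>M)" by simp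
    also have "\<dots> = N (v k) - 2 * ip (v k) (v n) + N (v n)"
      unfolding integral_norm_lincomb_squared[OF T[OF v] T[OF v]] N_def ip_def by simp
    also have "\<dots> = 2 * J (v k) + 2 * J (v n) - 4 * J z"
      unfolding J_def z by (simp add: algebra_simps power2_eq_square)
    also have "\<dots> \<le> 2 * (1/4) ^ Suc k + 2 * (1/4) ^ Suc n"
      using Jv[of k] Jv[of n] m_le[OF z(1)] by linarith
    also have "\<dots> \<le> (1/4) ^ min n k"
    proof -
      have "(1/4::real) ^ k \<le> (1/4) ^ min n k" "(1/4::real) ^ n \<le> (1/4) ^ min n k"
        by (auto intro!: power_decreasing)
      then show ?thesis unfolding power_Suc by linarith
    qed
    finally show ?thesis .
  qed
  obtain u where u: "square_integrable M u"
    and lim: "(\<lambda>n. \<integral>x. (norm (T (v n) x - u x))\<^sup>2 \<partial>M) \<longlonglongrightarrow> 0"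
    using fast_Cauchy_L2_limit[OF T[OF v] fast] by blast
  have "(\<integral>x. T w x \<bullet> u x \<partial>M) = L w" if w: "w \<in> V" for w
  proof -
    have "(\<lambda>n. ip (v n) w - L w) \<longlonglongrightarrow> 0"
    proof -
      \<comment> \<open>\<open>J (v\<^sub>n + t w) \<ge> m\<close> for all \<open>t\<close>, and \<open>J v\<^sub>n\<close> exceeds \<open>m\<close> only by the error.\<close>
      have "(ip (v n) w - L w)\<^sup>2 \<le> (1/4) ^ Suc n * N w" for n
      proof (rule discriminant_bound)
        fix t :: real
        obtain z where z: "z \<in> V"
            "N z = 1\<^sup>2 * N (v n) + 2 * 1 * t * ip (v n) w + t\<^sup>2 * N w"
            "L z = 1 * L (v n) + t * L w"
          using N_comb[OF v w, where a=1 and b=t] by blast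
        have "m \<le> J z" by (rule m_le) fact
        also have "J z = J (v n) + 2 * t * (ip (v n) w - L w) + t\<^sup>2 * N w"
          unfolding J_def z by (simp add: algebra_simps)
        finally show "0 \<le> (1/4) ^ Suc n + 2 * t * (ip (v n) w - L w) + t\<^sup>2 * N w"
          using Jv[of n] by linarith
      qed (use N_nonneg in simp_all)
      moreover have "(\<lambda>n. (1/4::real) ^ Suc n) \<longlonglongrightarrow> 0"
        by (intro LIMSEQ_Suc LIMSEQ_realpow_zero) auto
      ultimately show ?thesis by (rule tendsto_zero_of_square_le)
    qed
    moreover have "(\<lambda>n. ip (v n) w - (\<integral>x. T w x \<bullet> u x \<partial>M)) \<longlonglongrightarrow> 0"
    proof -
      have "(ip (v n) w - (\<integral>x. T w x \<bullet> u x \<partial>M))\<^sup>2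
          \<le> (\<integral>x. (norm (T (v n) x - u x))\<^sup>2 \<partial>M) * N w" for n
      proof -
        have "ip (v n) w - (\<integral>x. T w x \<bullet> u x \<partial>M) = (\<integral>x. (T (v n) x - u x) \<bullet> T w x \<partial>M)"
          using square_integrable_integrable_inner[OF T[OF v] T[OF w]]
            square_integrable_integrable_inner[OF u T[OF w]]
          by (simp add: ip_def inner_diff_left inner_commute[of "T w _" "u _"])
        then show ?thesis
          using integral_Cauchy_Schwarz[OF square_integrable_lincomb[OF T[OF v] u, where a=1 and b="-1"] T[OF w]]
          by (simp add: N_def)
      qed
      then show ?thesis using lim by (rule tendsto_zero_of_square_le)
    qed
    ultimately have "(\<lambda>n. (ip (v n) w - L w) - (ip (v n) w - (\<integral>x. T w x \<bullet> u x \<partial>M))) \<longlonglongrightarrow> 0 - 0"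
      by (rule tendsto_diff)
    then show ?thesis by (simp add: LIMSEQ_const_iff)
  qed
  with u show ?thesis by blast
qed

section \<open>Calculus on a rectangle\<close>

lemma has_vector_derivative_slice_fst:
  assumes F: "(F has_derivative L) (at (r, \<theta>) within A \<times> B)" and \<theta>: "\<theta> \<in> B"
  shows "((\<lambda>s. F (s, \<theta>)) has_vector_derivative L (1, 0)) (at r within A)"
proof -
  have "((\<lambda>s. (s, \<theta>)) has_derivative (\<lambda>h. (h, 0))) (at r within A)"
    by (auto intro!: derivative_eq_intros)
  moreover have "(F has_derivative L) (at (r, \<theta>) within (\<lambda>s. (s, \<theta>)) ` A)"
    by (rule has_derivative_subset[OF F]) (use \<theta> in auto)
  ultimately have "((\<lambda>s. F (s, \<theta>)) has_derivative (\<lambda>h. L (h, 0))) (at r within A)"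
    by (rule has_derivative_in_compose)
  moreover have "L (h, 0) = h *\<^sub>R L (1, 0)" for h
    using linear_scale[OF has_derivative_linear[OF F], of h "(1, 0)"] by simp
  then have "(\<lambda>h. L (h, 0)) = (\<lambda>h. h *\<^sub>R L (1, 0))" by (rule ext)
  ultimately show ?thesis unfolding has_vector_derivative_def by argo
qed

lemma has_vector_derivative_slice_snd:
  assumes F: "(F has_derivative L) (at (r, \<theta>) within A \<times> B)" and r: "r \<in> A"
  shows "((\<lambda>t. F (r, t)) has_vector_derivative L (0, 1)) (at \<theta> within B)"
proof -
  have "((\<lambda>t. (r, t)) has_derivative (\<lambda>h. (0, h))) (at \<theta> within B)"
    by (auto intro!: derivative_eq_intros)
  moreover have "(F has_derivative L) (at (r, \<theta>) within (\<lambda>t. (r, t)) ` B)"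
    by (rule has_derivative_subset[OF F]) (use r in auto)
  ultimately have "((\<lambda>t. F (r, t)) has_derivative (\<lambda>h. L (0, h))) (at \<theta> within B)"
    by (rule has_derivative_in_compose)
  moreover have "L (0, h) = h *\<^sub>R L (0, 1)" for h
    using linear_scale[OF has_derivative_linear[OF F], of h "(0, 1)"] by simp
  then have "(\<lambda>h. L (0, h)) = (\<lambda>h. h *\<^sub>R L (0, 1))" by (rule ext)
  ultimately show ?thesis unfolding has_vector_derivative_def by argo
qed

lemma integral_nonneg_open_interval:
  fixes g :: "real \<Rightarrow> real"
  assumes "\<And>x. x \<in> {c<..<d} \<Longrightarrow> 0 \<le> g x"
  shows "0 \<le> integral {c..d} g"
  unfolding integral_open_interval_real
  using assms by (cases "g integrable_on {c<..<d}")
    (auto intro: Henstock_Kurzweil_Integration.integral_nonneg simp: not_integrable_integral)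

text \<open>
  This and the next lemma are the divergence theorem on a rectangle in the form of an inequality:
  only the signs of the boundary terms are known, and only on the open sides.
\<close>

lemma integral_partial_snd_nonneg:
  fixes G g :: "real \<times> real \<Rightarrow> real"
  assumes "c \<le> d"
    and cont: "continuous_on (cbox (a, c) (b, d)) g"
    and deriv: "\<And>x y. x \<in> {a..b} \<Longrightarrow> y \<in> {c..d} \<Longrightarrow>
      ((\<lambda>t. G (x, t)) has_vector_derivative g (x, y)) (at y within {c..d})"
    and bdry: "\<And>x. x \<in> {a<..<b} \<Longrightarrow> G (x, c) \<le> G (x, d)"
  shows "0 \<le> integral (cbox (a, c) (b, d)) g"
proof -
  have eq: "integral (cbox (a, c) (b, d)) g = integral {a..b} (\<lambda>x. integral {c..d} (\<lambda>y. g (x, y)))"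
    using integral_prod_continuous[OF cont] by simp
  have nonneg: "0 \<le> integral {c..d} (\<lambda>y. g (x, y))" if "x \<in> {a<..<b}" for x
  proof -
    have "((\<lambda>y. g (x, y)) has_integral G (x, d) - G (x, c)) {c..d}"
      using that deriv assms(1) by (intro fundamental_theorem_of_calculus) auto
    then show ?thesis using bdry[OF that] by (simp add: integral_unique)
  qed
  show ?thesis unfolding eq by (rule integral_nonneg_open_interval) (rule nonneg)
qed

lemma integral_partial_fst_nonneg:
  fixes G g :: "real \<times> real \<Rightarrow> real"
  assumes "a \<le> b"
    and cont: "continuous_on (cbox (a, c) (b, d)) g"
    and deriv: "\<And>x y. x \<in> {a..b} \<Longrightarrow> y \<in> {c..d} \<Longrightarrow>
      ((\<lambda>s. G (s, y)) has_vector_derivative g (x, y)) (at x within {a..b})"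
    and bdry: "\<And>y. y \<in> {c<..<d} \<Longrightarrow> G (a, y) \<le> G (b, y)"
  shows "0 \<le> integral (cbox (a, c) (b, d)) g"
proof -
  have "integral (cbox (a, c) (b, d)) g = integral {a..b} (\<lambda>x. integral {c..d} (\<lambda>y. g (x, y)))"
    using integral_prod_continuous[OF cont] by simp
  also have "\<dots> = integral {c..d} (\<lambda>y. integral {a..b} (\<lambda>x. g (x, y)))"
    using integral_swap_continuous[of a c b d "\<lambda>x y. g (x, y)"] cont by simp
  finally have eq: "integral (cbox (a, c) (b, d)) g
    = integral {c..d} (\<lambda>y. integral {a..b} (\<lambda>x. g (x, y)))" .
  have nonneg: "0 \<le> integral {a..b} (\<lambda>x. g (x, y))" if "y \<in> {c<..<d}" for y
  proof -
    have "((\<lambda>x. g (x, y)) has_integral G (b, y) - G (a, y)) {a..b}"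
      using that deriv assms(1) by (intro fundamental_theorem_of_calculus) auto
    then show ?thesis using bdry[OF that] by (simp add: integral_unique)
  qed
  show ?thesis unfolding eq by (rule integral_nonneg_open_interval) (rule nonneg)
qed

lemma continuous_measurable_on_box:
  fixes g :: "'a::euclidean_space \<Rightarrow> 'b::euclidean_space"
  assumes "continuous_on (cbox a b) g"
  shows "g \<in> borel_measurable (lebesgue_on (box a b))"
  using continuous_on_subset[OF assms box_subset_cbox]
  by (intro continuous_imp_measurable_on_sets_lebesgue) auto

lemma continuous_integrable_on_box:
  fixes g :: "'a::euclidean_space \<Rightarrow> 'b::euclidean_space"
  assumes cont: "continuous_on (cbox a b) g"
  shows "integrable (lebesgue_on (box a b)) g"
proof -
  interpret finite_measure "lebesgue_on (box a b)"
    by (rule finite_measure_lebesgue_on) simp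
  obtain K where "\<And>x. x \<in> cbox a b \<Longrightarrow> norm (g x) \<le> K"
    using compact_imp_bounded[OF compact_continuous_image[OF cont compact_cbox]]
    by (fastforce simp: bounded_iff)
  then show ?thesis
    using continuous_measurable_on_box[OF cont] box_subset_cbox[of a b]
    by (intro integrable_const_bound[of _ K] AE_I2) (auto simp: space_restrict_space)
qed

lemma integral_box_eq_integral_cbox:
  fixes g :: "'a::euclidean_space \<Rightarrow> 'b::euclidean_space"
  assumes "continuous_on (cbox a b) g"
  shows "(LINT x|lebesgue_on (box a b). g x) = integral (cbox a b) g"
  using lebesgue_integral_eq_integral[OF continuous_integrable_on_box[OF assms]]
  by (simp add: integral_open_interval)

lemma continuous_square_integrable_on_box:
  fixes g :: "'a::euclidean_space \<Rightarrow> 'b::euclidean_space"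
  assumes "continuous_on (cbox a b) g"
  shows "square_integrable (lebesgue_on (box a b)) g"
  unfolding square_integrable_def
  by (intro conjI continuous_measurable_on_box continuous_integrable_on_box continuous_intros assms)

lemma C1_onE:
  assumes "C1_on S v"
  obtains v' where "continuous_on S v'"
    "\<And>x. x \<in> S \<Longrightarrow> (v has_derivative blinfun_apply (v' x)) (at x within S)"
  using assms unfolding C1_on_def by blast

lemma C1_on_continuous: "C1_on S v \<Longrightarrow> continuous_on S v"
  by (erule C1_onE) (rule has_derivative_continuous_on)

lemma C1_on_lincomb:
  assumes "C1_on S v" "C1_on S w"
  shows "C1_on S (\<lambda>x. \<alpha> *\<^sub>R v x + \<beta> *\<^sub>R w x)"
proof -
  obtain v' w' where "continuous_on S v'" "continuous_on S w'"
    and "\<And>x. x \<in> S \<Longrightarrow> (v has_derivative blinfun_apply (v' x)) (at x within S)"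
    and "\<And>x. x \<in> S \<Longrightarrow> (w has_derivative blinfun_apply (w' x)) (at x within S)"
    using assms by (metis C1_onE)
  then show ?thesis
    unfolding C1_on_def
    by (intro exI[of _ "\<lambda>x. \<alpha> *\<^sub>R v' x + \<beta> *\<^sub>R w' x"])
       (auto intro!: continuous_intros derivative_eq_intros simp: blinfun.add_left blinfun.scaleR_left)
qed

section \<open>Matrices\<close>

lemma bounded_bilinear_matrix_vector_mult:
  "bounded_bilinear ((*v) :: real^'n^'m \<Rightarrow> real^'n \<Rightarrow> real^'m)"
  unfolding bilinear_conv_bounded_bilinear[symmetric] bilinear_def
  by (auto intro!: linearI simp: matrix_vector_mult_add_rdistrib matrix_vector_right_distrib
      matrix_vector_mult_scaleR scaleR_matrix_vector_assoc)

lemma mat2_decompose: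
  "mat2 a b c d = a *\<^sub>R mat2 1 0 0 0 + b *\<^sub>R mat2 0 1 0 0 + c *\<^sub>R mat2 0 0 1 0 + d *\<^sub>R mat2 0 0 0 1"
  by (simp add: mat2_def vec_eq_iff forall_2)

lemma continuous_on_mat2:
  assumes "continuous_on S a" "continuous_on S b" "continuous_on S c" "continuous_on S d"
  shows "continuous_on S (\<lambda>x. mat2 (a x) (b x) (c x) (d x))"
  by (subst mat2_decompose) (intro continuous_intros assms)

lemma has_vector_derivative_scaleR_const:
  fixes K :: "'a::real_normed_vector"
  assumes "(g has_real_derivative g') F"
  shows "((\<lambda>x. g x *\<^sub>R K) has_vector_derivative g' *\<^sub>R K) F"
  using bounded_linear.has_vector_derivative[OF bounded_linear_scaleR_left] assms
  by (simp add: has_real_derivative_iff_has_vector_derivative)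

lemma has_vector_derivative_mat2:
  assumes "(a has_real_derivative a') F" "(b has_real_derivative b') F"
    "(c has_real_derivative c') F" "(d has_real_derivative d') F"
  shows "((\<lambda>x. mat2 (a x) (b x) (c x) (d x)) has_vector_derivative mat2 a' b' c' d') F"
  by (subst (1 2) mat2_decompose)
     (intro has_vector_derivative_add has_vector_derivative_scaleR_const assms)

lemma bounded_linear_transpose: "bounded_linear (transpose :: real^'n^'m \<Rightarrow> real^'m^'n)"
  unfolding linear_conv_bounded_linear[symmetric]
  by (rule linearI) (simp_all add: transpose_def vec_eq_iff)

lemma transpose_mult_inner_self:
  fixes A :: "real^'n^'n"
  shows "(transpose A *v w) \<bullet> w = (A *v w) \<bullet> w"
  by (metis transpose_matrix_vector dot_lmul_matrix inner_commute)

lemma minus_matrix_vector_mult: "(- A) *v w = - (A *v w)" for A :: "real^'n^'m"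
  by (simp add: vec_eq_iff matrix_vector_mult_def sum_negf)

lemma mat2_mult_inner:
  "(mat2 a b c d *v w) \<bullet> z = (a * w$1 + b * w$2) * z$1 + (c * w$1 + d * w$2) * z$2"
  by (simp add: mat2_def matrix_vector_mult_def inner_vec_def sum_2)

lemma mat2_symmetric_inner:
  "(mat2 a b b d *v w) \<bullet> z = (mat2 a b b d *v z) \<bullet> w"
  by (simp add: mat2_mult_inner algebra_simps)

section \<open>The background flow and its coefficients\<close>

locale conical_flow =
  fixes D :: flow
  assumes flow: "background_flow D" and mult: "multiplier_choice D"
begin

abbreviation (input) "I \<equiv> angles D"

lemma gam_gt_1: "gam D > 1" and A0_pos: "A0 D > 0"
  and angle_order: "0 < theta_min D" "theta_min D < theta_so D" "theta_so D < theta_max D"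
    "theta_max D < pi / 2"
  using flow by (simp_all add: background_flow_def)

lemma theta_ref_in: "theta_ref D \<in> I" and theta_so_in: "theta_so D \<in> I"
  using mult angle_order by (auto simp: multiplier_choice_def)

lemma sin_pos: "\<theta> \<in> I \<Longrightarrow> sin \<theta> > 0"
  using angle_order by (intro sin_gt_zero) auto

lemma flow_at:
  assumes "\<theta> \<in> I"
  shows U1_deriv: "(U1 D has_real_derivative U2 D \<theta>) (at \<theta> within I)"
    and U2_deriv_raw: "(U2 D has_real_derivative - U1 D \<theta> -
      (U1 D \<theta> * sin \<theta> + U2 D \<theta> * cos \<theta>) / ((1 - (M2 D \<theta>)\<^sup>2) * sin \<theta>)) (at \<theta> within I)"
    and rho_pos: "rho D \<theta> > 0"
    and c2_Bernoulli:
      "c2 D \<theta> = (gam D - 1) * (B0 D - 1 / 2 * ((U1 D \<theta>)\<^sup>2 + (U2 D \<theta>)\<^sup>2))"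
    and U1_pos: "U1 D \<theta> > 0" and U2_pos: "U2 D \<theta> > 0"
    and M1_less: "1 - (M1 D \<theta>)\<^sup>2 > 0" and M2_less: "1 - (M2 D \<theta>)\<^sup>2 > 0"
  using assms flow unfolding background_flow_def by blast+

lemma c2_pos: "\<theta> \<in> I \<Longrightarrow> c2 D \<theta> > 0"
  unfolding c2_def using rho_pos[of \<theta>] gam_gt_1 A0_pos by simp

lemma M1_squared: "\<theta> \<in> I \<Longrightarrow> (M1 D \<theta>)\<^sup>2 = (U1 D \<theta>)\<^sup>2 / c2 D \<theta>"
  and M2_squared: "\<theta> \<in> I \<Longrightarrow> (M2 D \<theta>)\<^sup>2 = (U2 D \<theta>)\<^sup>2 / c2 D \<theta>"
  using c2_pos by (simp_all add: M1_def M2_def power_divide less_imp_le)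

lemma A11_pos: "\<theta> \<in> I \<Longrightarrow> A11 D \<theta> > 0"
  using M1_less M1_squared c2_pos by (simp add: A11_def field_simps)

lemma A22_pos: "\<theta> \<in> I \<Longrightarrow> A22 D \<theta> > 0"
  using M2_less M2_squared c2_pos by (simp add: A22_def field_simps)

lemma one_minus_M2: "\<theta> \<in> I \<Longrightarrow> 1 - (M2 D \<theta>)\<^sup>2 = A22 D \<theta> / c2 D \<theta>"
  using M2_squared c2_pos by (force simp: A22_def field_simps)

text \<open>
  \<open>X\<close> is the numerator of the differential equation for \<open>U\<^sub>2\<close>, divided by \<open>sin \<theta>\<close>; the other two
  functions are the derivatives of \<open>U\<^sub>2\<close> and \<open>c\<^sup>2\<close> in terms of it.
\<close>

definition "X \<theta> = U1 D \<theta> + U2 D \<theta> * cot \<theta>"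
definition "dU2 \<theta> = - U1 D \<theta> - X \<theta> * c2 D \<theta> / A22 D \<theta>"
definition "dc2 \<theta> = (gam D - 1) * U2 D \<theta> * X \<theta> * c2 D \<theta> / A22 D \<theta>"

lemma X_times_sin: "\<theta> \<in> I \<Longrightarrow> U1 D \<theta> * sin \<theta> + U2 D \<theta> * cos \<theta> = X \<theta> * sin \<theta>"
  using sin_pos by (force simp: X_def cot_def field_simps)

lemma U2_deriv:
  assumes "\<theta> \<in> I"
  shows "(U2 D has_real_derivative dU2 \<theta>) (at \<theta> within I)"
  using U2_deriv_raw[OF assms] sin_pos[OF assms]
  by (simp add: X_times_sin[OF assms] one_minus_M2[OF assms] dU2_def)

lemma c2_deriv:
  assumes "\<theta> \<in> I"
  shows "(c2 D has_real_derivative dc2 \<theta>) (at \<theta> within I)"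
proof -
  have "((\<lambda>\<theta>. (gam D - 1) * (B0 D - 1 / 2 * ((U1 D \<theta>)\<^sup>2 + (U2 D \<theta>)\<^sup>2)))
      has_real_derivative dc2 \<theta>) (at \<theta> within I)"
    by (rule derivative_eq_intros U1_deriv U2_deriv assms refl)+
       (simp add: dc2_def dU2_def field_simps power2_eq_square)
  then show ?thesis
    unfolding has_field_derivative_def
    by (rule has_derivative_transform[rotated 2]) (use assms c2_Bernoulli in auto)
qed

text \<open>
  The coefficients of the potential equation after division by \<open>A\<^sub>2\<^sub>2\<close>, with their derivatives. The
  formula for \<open>db\<close> is the one in which the derivative will be needed, not the quotient rule.
\<close>

definition "a \<theta> = A11 D \<theta> / A22 D \<theta>"
definition "b \<theta> = A12 D \<theta> / A22 D \<theta>"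
definition "da \<theta> = ((dc2 \<theta> - 2 * U1 D \<theta> * U2 D \<theta>) * A22 D \<theta>
  - A11 D \<theta> * (dc2 \<theta> - 2 * U2 D \<theta> * dU2 \<theta>)) / (A22 D \<theta>)\<^sup>2"
definition "db \<theta> = (e1 D \<theta> - 2 * A11 D \<theta>) / A22 D \<theta> - b \<theta> * k2 D \<theta> + (b \<theta>)\<^sup>2"

lemma A11_deriv: "\<theta> \<in> I \<Longrightarrow>
    (A11 D has_real_derivative dc2 \<theta> - 2 * U1 D \<theta> * U2 D \<theta>) (at \<theta> within I)"
  unfolding A11_def[abs_def]
  by (rule derivative_eq_intros U1_deriv c2_deriv refl | assumption)+ simp

lemma A22_deriv: "\<theta> \<in> I \<Longrightarrow>
    (A22 D has_real_derivative dc2 \<theta> - 2 * U2 D \<theta> * dU2 \<theta>) (at \<theta> within I)"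
  unfolding A22_def[abs_def]
  by (rule derivative_eq_intros U2_deriv c2_deriv refl | assumption)+ simp

lemma A12_deriv: "\<theta> \<in> I \<Longrightarrow>
    (A12 D has_real_derivative - (U2 D \<theta>)\<^sup>2 - U1 D \<theta> * dU2 \<theta>) (at \<theta> within I)"
  unfolding A12_def[abs_def]
  by (rule derivative_eq_intros U1_deriv U2_deriv refl | assumption)+ (simp add: power2_eq_square)

lemma a_deriv:
  assumes "\<theta> \<in> I"
  shows "(a has_real_derivative da \<theta>) (at \<theta> within I)"
proof -
  have "A22 D \<theta> \<noteq> 0" using A22_pos[OF assms] by simp
  from DERIV_divide[OF A11_deriv[OF assms] A22_deriv[OF assms] this]
  show ?thesis by (simp add: a_def[abs_def] da_def power2_eq_square)
qed

lemma e1_eq: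
  assumes "\<theta> \<in> I"
  shows "e1 D \<theta> = 2 * c2 D \<theta> - (U2 D \<theta>)\<^sup>2
    + (gam D - 1) * U1 D \<theta> * (U2 D \<theta>)\<^sup>2 * X \<theta> / A22 D \<theta>"
  using sin_pos[OF assms] c2_pos[OF assms]
  unfolding e1_def X_times_sin[OF assms] one_minus_M2[OF assms]
  by (simp add: M2_squared[OF assms])

lemma e2_eq:
  assumes "\<theta> \<in> I"
  shows "e2 D \<theta> = (3 - gam D) * U2 D \<theta> * X \<theta>
    + (gam D + 1) * U2 D \<theta> * c2 D \<theta> / A22 D \<theta> * X \<theta> + (c2 D \<theta> - 2 * (U2 D \<theta>)\<^sup>2) * cot \<theta>"
  unfolding e2_def X_def[symmetric] one_minus_M2[OF assms] by simp

text \<open>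
  The identity on which the positivity of the system rests. The quotient rule expresses \<open>b'\<close> by the
  flow; that the result combines into \<open>e\<^sub>1\<close> and \<open>e\<^sub>2\<close> is special to solutions of the differential
  equation for \<open>U\<^sub>2\<close>.
\<close>

lemma b_deriv:
  assumes "\<theta> \<in> I"
  shows "(b has_real_derivative db \<theta>) (at \<theta> within I)"
proof -
  define u v c A t g where "u = U1 D \<theta>" "v = U2 D \<theta>" "c = c2 D \<theta>" "A = A22 D \<theta>" "t = cot \<theta>" "g = gam D"
  note defs = this
  have A: "A \<noteq> 0" using A22_pos[OF assms] by (simp add: defs)
  \<comment> \<open>Eliminating \<open>c\<^sup>2\<close> in favour of \<open>A\<^sub>2\<^sub>2\<close> leaves only powers of \<open>A\<^sub>2\<^sub>2\<close> in the denominators.\<close>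
  have c: "c = A + v\<^sup>2" by (simp add: defs A22_def)
  have "db \<theta> = ((- (U2 D \<theta>)\<^sup>2 - U1 D \<theta> * dU2 \<theta>) * A22 D \<theta>
      - A12 D \<theta> * (dc2 \<theta> - 2 * U2 D \<theta> * dU2 \<theta>)) / (A22 D \<theta> * A22 D \<theta>)"
    unfolding db_def b_def k2_def e1_eq[OF assms] e2_eq[OF assms] dU2_def dc2_def A11_def A12_def
      X_def defs[symmetric] c
    using A by (simp add: field_simps power2_eq_square)
  with DERIV_divide[OF A12_deriv[OF assms] A22_deriv[OF assms] A[unfolded defs]]
  show ?thesis by (simp add: b_def[abs_def])
qed

lemma flow_continuous:
  shows "continuous_on I (U1 D)" "continuous_on I (U2 D)" "continuous_on I (c2 D)"
    "continuous_on I (A11 D)" "continuous_on I (A12 D)" "continuous_on I (A22 D)"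
    "continuous_on I a" "continuous_on I b"
  by (rule DERIV_continuous_on, erule U1_deriv U2_deriv c2_deriv A11_deriv A12_deriv A22_deriv
      a_deriv b_deriv)+

lemma A22_nz: "\<theta> \<in> I \<Longrightarrow> A22 D \<theta> \<noteq> 0"
  using A22_pos by force

lemma cot_continuous: "continuous_on I cot"
  unfolding cot_def[abs_def] using sin_pos by (intro continuous_intros) force

lemma X_continuous: "continuous_on I X"
  unfolding X_def[abs_def] by (intro continuous_intros flow_continuous cot_continuous)

lemma e1_continuous: "continuous_on I (e1 D)"
proof -
  have "continuous_on I (\<lambda>\<theta>. 2 * c2 D \<theta> - (U2 D \<theta>)\<^sup>2
    + (gam D - 1) * U1 D \<theta> * (U2 D \<theta>)\<^sup>2 * X \<theta> / A22 D \<theta>)"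
    using A22_nz by (intro continuous_intros flow_continuous X_continuous) auto
  then show ?thesis by (rule continuous_on_eq) (simp add: e1_eq)
qed

lemma k2_continuous: "continuous_on I (k2 D)"
proof -
  have "continuous_on I (\<lambda>\<theta>. ((3 - gam D) * U2 D \<theta> * X \<theta>
    + (gam D + 1) * U2 D \<theta> * c2 D \<theta> / A22 D \<theta> * X \<theta>
    + (c2 D \<theta> - 2 * (U2 D \<theta>)\<^sup>2) * cot \<theta>) / A22 D \<theta>)"
    using A22_nz by (intro continuous_intros flow_continuous X_continuous cot_continuous) auto
  then show ?thesis by (rule continuous_on_eq) (simp add: e2_eq k2_def)
qed

lemma da_continuous: "continuous_on I da"
  unfolding da_def[abs_def] dc2_def dU2_def
  using A22_nz by (intro continuous_intros flow_continuous X_continuous) auto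

lemma db_continuous: "continuous_on I db"
  unfolding db_def[abs_def]
  using A22_nz
  by (intro continuous_intros flow_continuous X_continuous e1_continuous k2_continuous) auto

section \<open>The multipliers\<close>

definition "P \<theta> = (LBINT \<tau>=theta_so D..\<theta>. k2 D \<tau>)"

lemma FTC_on_angles:
  fixes g :: "real \<Rightarrow> real"
  assumes "continuous_on I g" "c \<in> I" "\<theta> \<in> I"
  shows "((\<lambda>\<theta>. LBINT \<tau>=c..\<theta>. g \<tau>) has_real_derivative g \<theta>) (at \<theta> within I)"
  using interval_integral_FTC2[of "theta_min D" c "theta_max D" g \<theta>] assms
  by (simp add: has_real_derivative_iff_has_vector_derivative)

lemma P_deriv: "\<theta> \<in> I \<Longrightarrow> (P has_real_derivative k2 D \<theta>) (at \<theta> within I)"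
  unfolding P_def[abs_def] by (rule FTC_on_angles[OF k2_continuous theta_so_in])

lemma P_continuous: "continuous_on I P"
  by (rule DERIV_continuous_on, erule P_deriv)

lemma integral_k2:
  assumes "s \<in> I" "\<theta> \<in> I"
  shows "(LBINT \<tau>=s..\<theta>. k2 D \<tau>) = P \<theta> - P s"
proof (rule interval_integral_FTC_finite)
  have sub: "{min s \<theta>..max s \<theta>} \<subseteq> I" using assms by auto
  show "continuous_on {min s \<theta>..max s \<theta>} (k2 D)"
    by (rule continuous_on_subset[OF k2_continuous sub])
  fix x assume "min s \<theta> \<le> x" "x \<le> max s \<theta>"
  then have "x \<in> I" using sub by auto
  from DERIV_subset[OF P_deriv[OF this] sub]
  show "(P has_vector_derivative k2 D x) (at x within {min s \<theta>..max s \<theta>})"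
    by (simp add: has_real_derivative_iff_has_vector_derivative)
qed

lemma wt_pos: "wt D \<theta> > 0"
  by (simp add: wt_def)

lemma wt_deriv:
  assumes "\<theta> \<in> I"
  shows "(wt D has_real_derivative b \<theta> * wt D \<theta>) (at \<theta> within I)"
proof -
  have "((\<lambda>\<theta>. LBINT \<tau>=theta_ref D..\<theta>. b \<tau>) has_real_derivative b \<theta>) (at \<theta> within I)"
    by (rule FTC_on_angles[OF flow_continuous(8) theta_ref_in assms])
  from DERIV_chain2[OF DERIV_exp this] show ?thesis
    by (simp add: wt_def[abs_def] b_def[abs_def] mult.commute)
qed

lemma dtheta_eqI:
  assumes "\<theta> \<in> I" "(g has_real_derivative g') (at \<theta> within I)"
  shows "dtheta D g \<theta> = g'"
  unfolding dtheta_def using assms angle_order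
  by (intro vector_derivative_within_closed_interval)
     (auto simp: has_real_derivative_iff_has_vector_derivative)

lemma d1_eq: "d1 D \<theta> = d1_so D * exp (P \<theta>)"
  by (simp add: d1_def P_def)

lemma d1_pos: "d1 D \<theta> > 0"
  using mult by (simp add: d1_eq multiplier_choice_def)

lemma d1_deriv: "\<theta> \<in> I \<Longrightarrow> (d1 D has_real_derivative k2 D \<theta> * d1 D \<theta>) (at \<theta> within I)"
  unfolding d1_eq[abs_def]
  by (rule derivative_eq_intros P_deriv refl | assumption)+ (simp add: algebra_simps)

text \<open>
  With \<open>\<integral>\<^sub>s\<^sup>\<theta> k\<^sub>2 = P(\<theta>) - P(s)\<close> the dependence on \<open>\<theta>\<close> leaves the inner integral, which makes
  \<open>d\<^sub>2\<close> accessible to the product rule.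
\<close>

lemma d2_eq:
  assumes "\<theta> \<in> I"
  shows "d2 D \<theta> = exp (2 * P \<theta>) *
    (d2_so D - 2 * d_star D * (LBINT s=theta_so D..\<theta>. exp (- 2 * P s)))"
proof -
  have "(LBINT s=theta_so D..\<theta>. exp (2 * (LBINT \<tau>=s..\<theta>. k2 D \<tau>)))
      = (LBINT s=theta_so D..\<theta>. exp (2 * P \<theta>) * exp (- 2 * P s))"
  proof (rule interval_integral_cong)
    fix s assume "s \<in> einterval (min (ereal (theta_so D)) (ereal \<theta>))
      (max (ereal (theta_so D)) (ereal \<theta>))"
    then have "s \<in> I"
      using assms theta_so_in by (auto simp: einterval_def min_def max_def split: if_splits)
    then show "exp (2 * (LBINT \<tau>=s..\<theta>. k2 D \<tau>)) = exp (2 * P \<theta>) * exp (- 2 * P s)"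
      using assms by (simp add: integral_k2 exp_add[symmetric] algebra_simps)
  qed
  then show ?thesis by (simp add: d2_def P_def[symmetric] algebra_simps)
qed

lemma d2_deriv:
  assumes "\<theta> \<in> I"
  shows "(d2 D has_real_derivative 2 * k2 D \<theta> * d2 D \<theta> - 2 * d_star D) (at \<theta> within I)"
proof -
  define J where "J \<theta> = (LBINT s=theta_so D..\<theta>. exp (- 2 * P s))" for \<theta> :: real
  have J: "(J has_real_derivative exp (- 2 * P \<theta>)) (at \<theta> within I)"
    unfolding J_def[abs_def]
    by (rule FTC_on_angles[OF _ theta_so_in assms]) (intro continuous_intros P_continuous)
  have "((\<lambda>\<theta>. exp (2 * P \<theta>) * (d2_so D - 2 * d_star D * J \<theta>))
      has_real_derivative 2 * k2 D \<theta> * d2 D \<theta> - 2 * d_star D) (at \<theta> within I)"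
    by (rule derivative_eq_intros P_deriv J assms refl)+
       (simp add: d2_eq[OF assms] J_def exp_minus field_simps)
  then show ?thesis
    unfolding has_field_derivative_def
    by (rule has_derivative_transform[rotated 2]) (use assms d2_eq in \<open>auto simp: J_def\<close>)
qed

lemma multiplier_continuous:
  "continuous_on I (wt D)" "continuous_on I (d1 D)" "continuous_on I (d2 D)"
  by (rule DERIV_continuous_on, erule wt_deriv d1_deriv d2_deriv)+

lemma d2_pos: "\<theta> \<in> I \<Longrightarrow> d2 D \<theta> > 0"
  using mult by (simp add: multiplier_choice_def)

lemma k11_eq: "\<theta> \<in> I \<Longrightarrow> k11 D \<theta> = a \<theta> - (b \<theta>)\<^sup>2"
proof -
  assume \<theta>: "\<theta> \<in> I"
  define u v c A where "u = U1 D \<theta>" "v = U2 D \<theta>" "c = c2 D \<theta>" "A = A22 D \<theta>"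
  note defs = this
  have A: "A \<noteq> 0" "c \<noteq> 0" using A22_pos[OF \<theta>] c2_pos[OF \<theta>] by (simp_all add: defs)
  have v: "v\<^sup>2 = c - A" by (simp add: defs A22_def)
  have "1 - (M1 D \<theta>)\<^sup>2 - (M2 D \<theta>)\<^sup>2 = (A - u\<^sup>2) / c"
    using one_minus_M2[OF \<theta>] M1_squared[OF \<theta>] by (simp add: defs diff_divide_distrib)
  then have "k11 D \<theta> = (A - u\<^sup>2) * c / A\<^sup>2"
    using A unfolding k11_def one_minus_M2[OF \<theta>] defs[symmetric]
    by (simp add: power2_eq_square)
  also have "\<dots> = (c - u\<^sup>2) / A - u\<^sup>2 * v\<^sup>2 / A\<^sup>2"
    unfolding v using A by (simp add: field_simps power2_eq_square)
  also have "\<dots> = a \<theta> - (b \<theta>)\<^sup>2"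
    by (simp add: a_def b_def A11_def A12_def defs power_divide power_mult_distrib)
  finally show ?thesis .
qed

text \<open>The derivative of \<open>k\<^sub>1\<^sub>1 d\<^sub>2\<close>.\<close>

definition "dk \<theta> = (da \<theta> - 2 * b \<theta> * db \<theta>) * d2 D \<theta>
  + (a \<theta> - (b \<theta>)\<^sup>2) * (2 * k2 D \<theta> * d2 D \<theta> - 2 * d_star D)"

lemma k11_d2_growth:
  assumes "\<theta> \<in> I"
  shows "dk \<theta> - (a \<theta> - (b \<theta>)\<^sup>2) * d1 D \<theta> \<ge> 4"
proof -
  have "((\<lambda>\<theta>. (a \<theta> - (b \<theta>)\<^sup>2) * d2 D \<theta>) has_real_derivative dk \<theta>) (at \<theta> within I)"
    by (rule derivative_eq_intros a_deriv b_deriv d2_deriv assms refl)+ (simp add: dk_def)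
  then have "((\<lambda>\<theta>. k11 D \<theta> * d2 D \<theta>) has_real_derivative dk \<theta>) (at \<theta> within I)"
    unfolding has_field_derivative_def
    by (rule has_derivative_transform[rotated 2]) (use assms k11_eq in auto)
  from dtheta_eqI[OF assms this] have "1 / 2 * (dk \<theta> - k11 D \<theta> * d1 D \<theta>) \<ge> 2"
    using assms mult unfolding multiplier_choice_def by metis
  then show ?thesis by (simp add: k11_eq[OF assms])
qed

text \<open>
  The essential supremum bounds \<open>d\<^sub>1\<close> only almost everywhere. The set where the bound holds is
  closed because \<open>d\<^sub>1\<close> is continuous, and a closed set that contains almost every point of an
  interval contains its closure. That the supremum is finite needs an argument as well, since the
  conversion to a real number sends infinite values to 0.
\<close>

lemma d1_le_d_star:
  assumes "\<theta> \<in> I"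
  shows "d1 D \<theta> \<le> d_star D"
proof -
  let ?S = "{theta_min D<..<theta_max D}" and ?L = "Linf_norm I (d1 D)"
  let ?E = "esssup (lebesgue_on I) (\<lambda>x. ereal \<bar>d1 D x\<bar>)"
  obtain K where K: "\<And>x. x \<in> I \<Longrightarrow> \<bar>d1 D x\<bar> \<le> K"
    using compact_imp_bounded[OF compact_continuous_image[OF multiplier_continuous(2)]]
    by (fastforce simp: bounded_iff)
  have meas: "(\<lambda>x. ereal \<bar>d1 D x\<bar>) \<in> borel_measurable (lebesgue_on I)"
    using continuous_imp_measurable_on_sets_lebesgue[OF multiplier_continuous(2)]
      fmeasurableD[OF lmeasurable_interval(1)] by measurable
  have ae: "AE x in lebesgue_on I. ereal \<bar>d1 D x\<bar> \<le> ?E" by (rule esssup_AE)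
  have "?E \<le> ereal K"
    using K by (intro esssup_I meas) (auto intro!: AE_I2)
  moreover have "?E \<noteq> - \<infinity>"
  proof
    assume "?E = - \<infinity>"
    with ae have "AE x in lebesgue_on I. False" by simp
    then have "emeasure (lebesgue_on I) (space (lebesgue_on I)) = 0"
      by (simp only: eventually_const_iff ae_filter_eq_bot_iff simp_thms)
    then show False using angle_order by (simp add: emeasure_restrict_space)
  qed
  ultimately have E: "?E = ereal ?L" unfolding Linf_norm_def by (cases ?E) auto
  have "AE x in lebesgue. x \<in> I \<longrightarrow> d1 D x \<le> ?L"
    using ae unfolding E by (subst (asm) AE_restrict_space_iff) (auto elim!: eventually_mono)
  then have "AE x \<in> ?S in lebesgue. x \<in> {x \<in> I. d1 D x \<le> ?L}" by eventually_elim auto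
  moreover have cl: "closed {x \<in> I. d1 D x \<le> ?L}"
    by (intro continuous_on_closed_Collect_le multiplier_continuous continuous_intros closed_atLeastAtMost)
  ultimately have "?S \<subseteq> {x \<in> I. d1 D x \<le> ?L}"
    using mem_closed_if_AE_lebesgue_open[OF open_greaterThanLessThan] by blast
  then have "closure ?S \<subseteq> {x \<in> I. d1 D x \<le> ?L}" using cl by (rule closure_minimal)
  then show ?thesis using assms angle_order unfolding d_star_def by auto
qed

lemma d_star_ge_4: "d_star D \<ge> 4"
  by (simp add: d_star_def)

text \<open>
  \<open>p = A\<^sub>2\<^sub>2 l\<^sub>1\<close> and \<open>q = A\<^sub>2\<^sub>2 l\<^sub>2\<close>. The products of \<open>l\<^sub>1\<close>, \<open>l\<^sub>2\<close> with \<open>A\<^sub>1\<^sub>1\<close>, \<open>A\<^sub>1\<^sub>2\<close>, \<open>A\<^sub>2\<^sub>2\<close> that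
  occur in the matrices are polynomials in \<open>a\<close>, \<open>b\<close>, \<open>p\<close>, \<open>q\<close>.
\<close>

definition "p \<theta> = (b \<theta> * d2 D \<theta> - d1 D \<theta>) / wt D \<theta>"
definition "q \<theta> = d2 D \<theta> / wt D \<theta>"
definition "dp \<theta> = (db \<theta> * d2 D \<theta> + b \<theta> * (2 * k2 D \<theta> * d2 D \<theta> - 2 * d_star D)
  - k2 D \<theta> * d1 D \<theta> - b \<theta> * (b \<theta> * d2 D \<theta> - d1 D \<theta>)) / wt D \<theta>"
definition "dq \<theta> = (2 * k2 D \<theta> * d2 D \<theta> - 2 * d_star D - b \<theta> * d2 D \<theta>) / wt D \<theta>"

lemma b_neg: "\<theta> \<in> I \<Longrightarrow> b \<theta> < 0"
  using U1_pos U2_pos A22_pos by (simp add: b_def A12_def divide_neg_pos)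

lemma l1_eq: "\<theta> \<in> I \<Longrightarrow> l1 D \<theta> = p \<theta> / A22 D \<theta>"
  using wt_pos[of \<theta>] by (simp add: l1_def p_def dtheta_eqI[OF _ wt_deriv] field_simps)

lemma l2_eq: "l2 D \<theta> = q \<theta> / A22 D \<theta>"
  by (simp add: l2_def q_def)

lemma q_pos: "\<theta> \<in> I \<Longrightarrow> q \<theta> > 0"
  using d2_pos wt_pos by (simp add: q_def)

lemma p_neg: "\<theta> \<in> I \<Longrightarrow> p \<theta> < 0"
proof -
  assume \<theta>: "\<theta> \<in> I"
  have "b \<theta> * d2 D \<theta> < 0" using b_neg[OF \<theta>] d2_pos[OF \<theta>] by (rule mult_neg_pos)
  then show ?thesis unfolding p_def using d1_pos[of \<theta>] wt_pos[of \<theta>] by (simp add: divide_neg_pos)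
qed

lemma l1_neg: "\<theta> \<in> I \<Longrightarrow> l1 D \<theta> < 0"
  using p_neg A22_pos by (simp add: l1_eq divide_neg_pos)

lemma l2_pos: "\<theta> \<in> I \<Longrightarrow> l2 D \<theta> > 0"
  using q_pos A22_pos by (simp add: l2_eq)

lemma p_deriv:
  assumes "\<theta> \<in> I"
  shows "(p has_real_derivative dp \<theta>) (at \<theta> within I)"
proof -
  have nz: "wt D \<theta> \<noteq> 0" using wt_pos[of \<theta>] by simp
  show ?thesis
    unfolding p_def[abs_def] dp_def
    by (rule derivative_eq_intros b_deriv d1_deriv d2_deriv wt_deriv assms nz refl)+
       (use nz in \<open>simp add: field_simps\<close>)
qed

lemma q_deriv:
  assumes "\<theta> \<in> I"
  shows "(q has_real_derivative dq \<theta>) (at \<theta> within I)"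
proof -
  have nz: "wt D \<theta> \<noteq> 0" using wt_pos[of \<theta>] by simp
  show ?thesis
    unfolding q_def[abs_def] dq_def
    by (rule derivative_eq_intros d2_deriv wt_deriv assms nz refl)+
       (use nz in \<open>simp add: field_simps\<close>)
qed

lemma wt_nz: "wt D \<theta> \<noteq> 0"
  using wt_pos[of \<theta>] by simp

lemma pq_continuous:
  "continuous_on I p" "continuous_on I q" "continuous_on I dp" "continuous_on I dq"
  unfolding p_def[abs_def] q_def[abs_def] dp_def[abs_def] dq_def[abs_def]
  using wt_nz
  by (intro continuous_intros flow_continuous db_continuous k2_continuous multiplier_continuous;
      simp)+

section \<open>Positivity of the zeroth order term\<close>

text \<open>
  The angular parts of the matrices: \<open>\<A>\<^sup>(\<^sup>1\<^sup>) = r\<^sup>3 N1\<close>, \<open>\<A>\<^sup>(\<^sup>2\<^sup>) = r\<^sup>2 N2\<close>, \<open>\<A>\<^sup>(\<^sup>3\<^sup>) = 2 r\<^sup>2 N3\<close> and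
  \<open>\<Q> = r\<^sup>2 NQ\<close>. The factor 3 in \<open>NQ\<close> is \<open>\<mu>\<^sub>1\<close>, from the radial derivative of \<open>r\<^sup>3\<close>.
\<close>

definition "N1 \<theta> = mat2 (a \<theta> * p \<theta>) (a \<theta> * q \<theta>) (a \<theta> * q \<theta>) (2 * b \<theta> * q \<theta> - p \<theta>)"
definition "N2 \<theta> = mat2 (2 * b \<theta> * p \<theta> - a \<theta> * q \<theta>) (p \<theta>) (p \<theta>) (q \<theta>)"
definition "dN2 \<theta> = mat2
  (2 * (db \<theta> * p \<theta> + b \<theta> * dp \<theta>) - (da \<theta> * q \<theta> + a \<theta> * dq \<theta>)) (dp \<theta>) (dp \<theta>) (dq \<theta>)"
definition "N3 \<theta> = mat2
  (p \<theta> * e1 D \<theta> / A22 D \<theta>) (p \<theta> * k2 D \<theta> + a \<theta> * q \<theta>)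
  (q \<theta> * e1 D \<theta> / A22 D \<theta>) (q \<theta> * k2 D \<theta> + 2 * b \<theta> * q \<theta> - p \<theta>)"
definition "NQ \<theta> = 2 *\<^sub>R N3 \<theta> - 3 *\<^sub>R N1 \<theta> - dN2 \<theta>"

lemma calA1_eq: "\<theta> \<in> I \<Longrightarrow> calA1 D (r, \<theta>) = r ^ 3 *\<^sub>R N1 \<theta>"
  and calA2_eq: "\<theta> \<in> I \<Longrightarrow> calA2 D (r, \<theta>) = r\<^sup>2 *\<^sub>R N2 \<theta>"
  and calA3_eq: "\<theta> \<in> I \<Longrightarrow> calA3 D (r, \<theta>) = (2 * r\<^sup>2) *\<^sub>R N3 \<theta>"
  using A22_nz[of \<theta>]
  by (simp_all add: calA1_def calA2_def calA3_def N1_def N2_def N3_def l1_eq l2_eq a_def b_def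
      k2_def field_simps)

lemma N_continuous:
  "continuous_on I N1" "continuous_on I N2" "continuous_on I dN2" "continuous_on I NQ"
  unfolding N1_def[abs_def] N2_def[abs_def] dN2_def[abs_def] NQ_def[abs_def] N3_def[abs_def]
  using A22_nz
  by (intro continuous_intros continuous_on_mat2 flow_continuous da_continuous db_continuous
      k2_continuous e1_continuous pq_continuous; simp)+

lemma N2_deriv:
  assumes "\<theta> \<in> I"
  shows "(N2 has_vector_derivative dN2 \<theta>) (at \<theta> within I)"
proof -
  have "((\<lambda>\<theta>. 2 * b \<theta> * p \<theta> - a \<theta> * q \<theta>) has_real_derivative
      2 * (db \<theta> * p \<theta> + b \<theta> * dp \<theta>) - (da \<theta> * q \<theta> + a \<theta> * dq \<theta>)) (at \<theta> within I)"
    by (rule derivative_eq_intros a_deriv b_deriv p_deriv q_deriv assms refl)+ simp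
  then show ?thesis
    unfolding N2_def[abs_def] dN2_def
    by (intro has_vector_derivative_mat2 p_deriv q_deriv assms)
qed

text \<open>
  Expanding \<open>NQ\<close>, the coefficients of \<open>w\<^sub>1 w\<^sub>2\<close> and \<open>w\<^sub>1\<^sup>2\<close> differ from those of the right hand side
  by multiples of one and the same expression \<open>(e\<^sub>1 - 2 A\<^sub>1\<^sub>1) / A\<^sub>2\<^sub>2 - b k\<^sub>2 + b\<^sup>2 - b'\<close>, which
  vanishes by the equations of the flow.
\<close>

lemma NQ_quadratic_form:
  assumes "\<theta> \<in> I"
  shows "wt D \<theta> * ((NQ \<theta> *v w) \<bullet> w) =
    (2 * d_star D - d1 D \<theta>) * (w$2 + b \<theta> * w$1)\<^sup>2
      + (dk \<theta> - (a \<theta> - (b \<theta>)\<^sup>2) * d1 D \<theta>) * (w$1)\<^sup>2"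
proof -
  have db: "e1 D \<theta> / A22 D \<theta> = db \<theta> + b \<theta> * k2 D \<theta> - (b \<theta>)\<^sup>2 + 2 * a \<theta>"
    using A22_nz[OF assms] by (simp add: db_def a_def diff_divide_distrib)
  have e: "p \<theta> * e1 D \<theta> / A22 D \<theta> = p \<theta> * (e1 D \<theta> / A22 D \<theta>)"
    "q \<theta> * e1 D \<theta> / A22 D \<theta> = q \<theta> * (e1 D \<theta> / A22 D \<theta>)" by simp_all
  \<comment> \<open>Multiplying by \<open>wt\<close> removes all remaining denominators.\<close>
  have pq: "wt D \<theta> * p \<theta> = b \<theta> * d2 D \<theta> - d1 D \<theta>" "wt D \<theta> * q \<theta> = d2 D \<theta>"
     "wt D \<theta> * dp \<theta> = db \<theta> * d2 D \<theta> + b \<theta> * (2 * k2 D \<theta> * d2 D \<theta> - 2 * d_star D)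
  - k2 D \<theta> * d1 D \<theta> - b \<theta> * (b \<theta> * d2 D \<theta> - d1 D \<theta>)"
     "wt D \<theta> * dq \<theta> = 2 * k2 D \<theta> * d2 D \<theta> - 2 * d_star D - b \<theta> * d2 D \<theta>"
    using wt_nz by (simp_all add: p_def q_def dp_def dq_def)
  show ?thesis
    unfolding NQ_def N1_def N3_def dN2_def matrix_vector_mult_diff_rdistrib
      scaleR_matrix_vector_assoc[symmetric] inner_diff_left inner_scaleR_left mat2_mult_inner
      e db dk_def
    using pq by algebra
qed

text \<open>
  Both squares have coefficients at least 4, and the linear map \<open>w \<mapsto> (w\<^sub>1, w\<^sub>2 + b w\<^sub>1)\<close> is invertible
  with constants that are uniform by compactness of the angular interval.
\<close>

lemma NQ_coercive:
  "\<exists>c>0. \<forall>\<theta>\<in>I. \<forall>w. c * (norm w)\<^sup>2 \<le> (NQ \<theta> *v w) \<bullet> w"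
proof -
  \<comment> \<open>With \<open>y = w\<^sub>2 + b w\<^sub>1\<close> one has \<open>\<parallel>w\<parallel>\<^sup>2 \<le> (2 + 2 b\<^sup>2) (w\<^sub>1\<^sup>2 + y\<^sup>2)\<close>.\<close>
  define h where "h \<theta> = 4 / (wt D \<theta> * (2 + 2 * (b \<theta>)\<^sup>2))" for \<theta>
  have den: "2 + 2 * (b \<theta>)\<^sup>2 > 0" for \<theta> using zero_le_power2[of "b \<theta>"] by linarith
  have "continuous_on I h"
    unfolding h_def[abs_def] using den wt_nz
    by (intro continuous_intros flow_continuous multiplier_continuous) (simp add: less_imp_neq[symmetric])
  moreover have "I \<noteq> {}" using theta_so_in by blast
  ultimately obtain \<theta>0 where \<theta>0: "\<theta>0 \<in> I" "\<And>\<theta>. \<theta> \<in> I \<Longrightarrow> h \<theta>0 \<le> h \<theta>"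
    using continuous_attains_inf[OF compact_Icc] by blast
  have "h \<theta>0 > 0" using wt_pos den by (simp add: h_def)
  moreover have "h \<theta>0 * (norm w)\<^sup>2 \<le> (NQ \<theta> *v w) \<bullet> w" if \<theta>: "\<theta> \<in> I" for \<theta> w
  proof -
    let ?x = "w$1" and ?y = "w$2 + b \<theta> * w$1"
    have "(norm w)\<^sup>2 = ?x\<^sup>2 + (?y - b \<theta> * ?x)\<^sup>2"
      unfolding power2_norm_eq_inner by (simp add: inner_vec_def sum_2 power2_eq_square)
    also have "(?y - b \<theta> * ?x)\<^sup>2 \<le> 2 * ?y\<^sup>2 + 2 * (b \<theta> * ?x)\<^sup>2"
      using zero_le_power2[of "?y + b \<theta> * ?x"] by (simp add: power2_eq_square algebra_simps)
    also have "?x\<^sup>2 + (2 * ?y\<^sup>2 + 2 * (b \<theta> * ?x)\<^sup>2) \<le> (2 + 2 * (b \<theta>)\<^sup>2) * (?x\<^sup>2 + ?y\<^sup>2)"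
      using mult_nonneg_nonneg[OF zero_le_power2[of "b \<theta>"] zero_le_power2[of ?y]]
        zero_le_power2[of ?x]
      unfolding power_mult_distrib by (simp add: ring_distribs del: zero_le_power2)
    finally have 1: "(norm w)\<^sup>2 \<le> (2 + 2 * (b \<theta>)\<^sup>2) * (?x\<^sup>2 + ?y\<^sup>2)" by simp
    have "4 * (?x\<^sup>2 + ?y\<^sup>2) \<le> wt D \<theta> * ((NQ \<theta> *v w) \<bullet> w)"
    proof -
      have "4 * ?y\<^sup>2 \<le> (2 * d_star D - d1 D \<theta>) * ?y\<^sup>2"
        using d1_le_d_star[OF \<theta>] d_star_ge_4 by (intro mult_right_mono) auto
      moreover have "4 * ?x\<^sup>2 \<le> (dk \<theta> - (a \<theta> - (b \<theta>)\<^sup>2) * d1 D \<theta>) * ?x\<^sup>2"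
        using k11_d2_growth[OF \<theta>] by (intro mult_right_mono) auto
      ultimately have "4 * ?y\<^sup>2 + 4 * ?x\<^sup>2 \<le> wt D \<theta> * ((NQ \<theta> *v w) \<bullet> w)"
        unfolding NQ_quadratic_form[OF \<theta>] by (rule add_mono)
      then show ?thesis by (simp only: distrib_left add.commute)
    qed
    then have 2: "4 * (?x\<^sup>2 + ?y\<^sup>2) / wt D \<theta> \<le> (NQ \<theta> *v w) \<bullet> w"
      using wt_pos[of \<theta>] by (simp add: field_simps)
    have "h \<theta>0 * (norm w)\<^sup>2 \<le> h \<theta> * (norm w)\<^sup>2"
      using \<theta>0(2)[OF \<theta>] by (intro mult_right_mono) auto
    also have "\<dots> \<le> h \<theta> * ((2 + 2 * (b \<theta>)\<^sup>2) * (?x\<^sup>2 + ?y\<^sup>2))"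
      using wt_pos[of \<theta>] den[of \<theta>] by (intro mult_left_mono[OF 1]) (simp add: h_def)
    also have "\<dots> = 4 * (?x\<^sup>2 + ?y\<^sup>2) / wt D \<theta>"
      using wt_nz[of \<theta>] den[of \<theta>] by (simp add: h_def)
    finally show ?thesis using 2 by linarith
  qed
  ultimately show ?thesis by blast
qed

section \<open>Dissipative boundary conditions\<close>

abbreviation (input) "lo \<equiv> theta_so D - sigma0 D"
abbreviation (input) "hi \<equiv> theta_max D"

lemma lo_less_hi: "lo < hi" and lo_ge: "theta_min D \<le> lo"
  using mult angle_order by (auto simp: multiplier_choice_def)

lemma K4_pos: "\<theta> \<in> {lo..hi} \<Longrightarrow> K4 D \<theta> > 0"
  using mult by (auto simp: multiplier_choice_def)

lemma in_angles: "\<theta> \<in> {lo..hi} \<Longrightarrow> \<theta> \<in> I"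
  using lo_ge by auto

lemma Omega1_eq_box: "Omega1 D r0 r1 = box (r0, lo) (r1, hi)"
  by (auto simp: Omega1_def box_prod[of "(_, _)"])

lemma closure_Omega1:
  assumes "r0 < r1"
  shows "closure (Omega1 D r0 r1) = cbox (r0, lo) (r1, hi)"
proof -
  have "box (r0, lo) (r1, hi) \<noteq> {}" using assms lo_less_hi by (simp add: box_prod[of "(_, _)"])
  then show ?thesis unfolding Omega1_eq_box by (rule closure_box)
qed

text \<open>
  By symmetry of \<open>\<G>\<close>, \<open>\<M>\<^sup>* = \<G> + \<B> = 2 \<B>\<^sub>+\<close>, so the adjoint condition removes \<open>\<B>\<^sub>+\<close> from the
  boundary form. On each side \<open>\<B>\<^sub>-\<close> is minus a positive multiple of the square of a linear form.
\<close>

lemma boundary_dissipative: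
  assumes \<theta>: "\<theta> \<in> {lo..hi}" and r: "r > 0" and bc: "M_adj D v s (r, \<theta>) = 0"
  shows "(calB D s (r, \<theta>) *v v (r, \<theta>)) \<bullet> v (r, \<theta>) \<le> 0"
proof -
  let ?w = "v (r, \<theta>)"
  have l: "l1 D \<theta> < 0" "l2 D \<theta> > 0" and K: "K4 D \<theta> > 0"
    and A: "A11 D \<theta> > 0" "A22 D \<theta> > 0"
    using l1_neg l2_pos K4_pos A11_pos A22_pos \<theta> in_angles by auto
  have B: "calB D s (r, \<theta>) = B_plus D s (r, \<theta>) + B_minus D s (r, \<theta>)"
    using l by (intro calB_split) auto
  have "transpose (calG D s (r, \<theta>)) = calG D s (r, \<theta>)"
    by (cases s) (simp_all add: calG_def transpose_def mat2_def vec_eq_iff forall_2)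
  then have "M_adj D v s (r, \<theta>) = 2 *\<^sub>R (B_plus D s (r, \<theta>) *v ?w)"
    by (simp add: M_adj_def calG_def B matrix_vector_mult_diff_rdistrib
        matrix_vector_mult_add_rdistrib scaleR_2)
  with bc have "B_plus D s (r, \<theta>) *v ?w = 0" by simp
  then have eq: "(calB D s (r, \<theta>) *v ?w) \<bullet> ?w = (B_minus D s (r, \<theta>) *v ?w) \<bullet> ?w"
    by (simp add: B matrix_vector_mult_add_rdistrib)
  show ?thesis
    unfolding eq
  proof (cases s)
    case R_inner
    have "0 \<le> r ^ 3 * (K4 D \<theta> * (?w$2)\<^sup>2)" using r K by simp
    then show "(B_minus D s (r, \<theta>) *v ?w) \<bullet> ?w \<le> 0"
      by (simp add: R_inner scaleR_matrix_vector_assoc[symmetric] minus_matrix_vector_mult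
          mat2_mult_inner power2_eq_square algebra_simps)
  next
    case R_outer
    have "0 \<le> r ^ 3 * A11 D \<theta> * (- l1 D \<theta>) * (?w$1 + l2 D \<theta> / l1 D \<theta> * ?w$2)\<^sup>2"
      using r l A by (intro mult_nonneg_nonneg) auto
    then show "(B_minus D s (r, \<theta>) *v ?w) \<bullet> ?w \<le> 0"
      by (simp add: R_outer scaleR_matrix_vector_assoc[symmetric] minus_matrix_vector_mult
          mat2_mult_inner power2_eq_square algebra_simps)
  next
    case Theta_lower
    have "0 \<le> r\<^sup>2 * A22 D \<theta> * l2 D \<theta> * (l1 D \<theta> / l2 D \<theta> * ?w$1 + ?w$2)\<^sup>2"
      using r l A by (intro mult_nonneg_nonneg) auto
    then show "(B_minus D s (r, \<theta>) *v ?w) \<bullet> ?w \<le> 0"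
      by (simp add: Theta_lower scaleR_matrix_vector_assoc[symmetric] minus_matrix_vector_mult
          mat2_mult_inner power2_eq_square algebra_simps)
  next
    case Theta_upper
    have "0 \<le> r\<^sup>2 * (K4 D \<theta> * (- l1 D \<theta>) / l2 D \<theta>) * (?w$1)\<^sup>2"
      using r l K by (intro mult_nonneg_nonneg divide_nonneg_nonneg) auto
    then show "(B_minus D s (r, \<theta>) *v ?w) \<bullet> ?w \<le> 0"
      by (simp add: Theta_upper scaleR_matrix_vector_assoc[symmetric] minus_matrix_vector_mult
          mat2_mult_inner power2_eq_square algebra_simps)
  qed
qed

section \<open>The adjoint operator on test functions\<close>

text \<open>
  Nothing is known about the coefficients outside the angular interval, so a two-sided derivative
  has to be read off from a formula that holds on the interval.
\<close>

lemma partial_theta_eqI: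
  assumes \<theta>: "\<theta> \<in> {lo<..<hi}" and eq: "\<And>t. t \<in> I \<Longrightarrow> F (r, t) = g t"
    and g: "(g has_vector_derivative g') (at \<theta> within I)"
  shows "partial_theta F (r, \<theta>) = g'"
proof -
  have "\<theta> \<in> interior I" using \<theta> lo_ge by simp
  from g have "(g has_vector_derivative g') (at \<theta>)"
    unfolding at_within_interior[OF \<open>\<theta> \<in> interior I\<close>] .
  then have "((\<lambda>t. F (r, t)) has_vector_derivative g') (at \<theta>)"
    by (rule has_vector_derivative_transform_within_open[OF _ open_greaterThanLessThan \<theta>])
       (use eq lo_ge in auto)
  then show ?thesis by (simp add: partial_theta_def vector_derivative_at)
qed

lemma partial_r_eqI:
  assumes "\<And>s. F (s, \<theta>) = g s" and "(g has_vector_derivative g') (at r)"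
  shows "partial_r F (r, \<theta>) = g'"
  using assms by (simp add: partial_r_def vector_derivative_at)

lemma power_deriv: "((\<lambda>s. s ^ 3) has_real_derivative 3 * r\<^sup>2) (at r within S)" for r :: real
  by (auto intro!: derivative_eq_intros)

lemma calQ_interior:
  assumes \<theta>: "\<theta> \<in> {lo<..<hi}"
  shows "calQ D (r, \<theta>) = r\<^sup>2 *\<^sub>R NQ \<theta>"
proof -
  have \<theta>I: "\<theta> \<in> I" using \<theta> by (intro in_angles) auto
  have 1: "partial_r (calA1 D) (r, \<theta>) = (3 * r\<^sup>2) *\<^sub>R N1 \<theta>"
    by (rule partial_r_eqI[where g="\<lambda>s. s ^ 3 *\<^sub>R N1 \<theta>"], rule calA1_eq[OF \<theta>I])
       (intro has_vector_derivative_scaleR_const power_deriv)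
  have 2: "partial_theta (calA2 D) (r, \<theta>) = r\<^sup>2 *\<^sub>R dN2 \<theta>"
    by (rule partial_theta_eqI[OF \<theta>, where g="\<lambda>t. r\<^sup>2 *\<^sub>R N2 t"], erule calA2_eq)
       (rule bounded_linear.has_vector_derivative[OF bounded_linear_scaleR_right N2_deriv[OF \<theta>I]])
  show ?thesis
    unfolding calQ_def 1 2 calA3_eq[OF \<theta>I] NQ_def
    by (simp only: scaleR_diff_right scaleR_scaleR mult.commute)
qed

text \<open>
  The adjoint operator as a function of the value \<open>w\<close> and the partial derivatives \<open>y\<close>, \<open>z\<close> of the
  test function. Unlike the operator itself this expression makes sense up to the boundary, where
  it is continuous along \<open>C\<^sup>1\<close> functions.
\<close>

definition K_coeff :: "real \<Rightarrow> real \<Rightarrow> real^2 \<Rightarrow> real^2 \<Rightarrow> real^2 \<Rightarrow> real^2" where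
  "K_coeff r \<theta> w y z = - ((2 * r ^ 3) *\<^sub>R (N1 \<theta> *v y)) - (2 * r\<^sup>2) *\<^sub>R (N2 \<theta> *v z)
    - (3 * r\<^sup>2) *\<^sub>R (N1 \<theta> *v w) - r\<^sup>2 *\<^sub>R (dN2 \<theta> *v w) + r\<^sup>2 *\<^sub>R (transpose (NQ \<theta>) *v w)"

lemma K_adj_interior:
  assumes \<theta>: "\<theta> \<in> {lo<..<hi}" and v: "(v has_derivative L) (at (r, \<theta>))"
  shows "K_adj D v (r, \<theta>) = K_coeff r \<theta> (v (r, \<theta>)) (L (1, 0)) (L (0, 1))"
proof -
  have \<theta>I: "\<theta> \<in> I" using \<theta> by (intro in_angles) auto
  have v': "(v has_derivative L) (at (r, \<theta>) within UNIV \<times> UNIV)" using v by simp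
  have vr: "((\<lambda>s. v (s, \<theta>)) has_vector_derivative L (1, 0)) (at r)"
    using has_vector_derivative_slice_fst[OF v'] by simp
  have vt: "((\<lambda>t. v (r, t)) has_vector_derivative L (0, 1)) (at \<theta>)"
    using has_vector_derivative_slice_snd[OF v'] by simp
  have 1: "partial_r v (r, \<theta>) = L (1, 0)"
    by (rule partial_r_eqI[OF refl vr])
  have 2: "partial_theta v (r, \<theta>) = L (0, 1)"
    using vt by (simp add: partial_theta_def vector_derivative_at)
  have 3: "partial_r (\<lambda>y. calA1 D y *v v y) (r, \<theta>)
      = r ^ 3 *\<^sub>R (N1 \<theta> *v L (1, 0)) + (3 * r\<^sup>2) *\<^sub>R (N1 \<theta> *v v (r, \<theta>))"
    by (rule partial_r_eqI[where g="\<lambda>s. s ^ 3 *\<^sub>R (N1 \<theta> *v v (s, \<theta>))"])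
       (simp add: calA1_eq[OF \<theta>I] scaleR_matrix_vector_assoc,
         rule has_vector_derivative_scaleR[OF power_deriv
           bounded_linear.has_vector_derivative[OF matrix_vector_mul_bounded_linear vr]])
  have 4: "partial_theta (\<lambda>y. calA2 D y *v v y) (r, \<theta>)
      = r\<^sup>2 *\<^sub>R (N2 \<theta> *v L (0, 1) + dN2 \<theta> *v v (r, \<theta>))"
    by (rule partial_theta_eqI[OF \<theta>, where g="\<lambda>t. r\<^sup>2 *\<^sub>R (N2 t *v v (r, t))"])
       (simp add: calA2_eq scaleR_matrix_vector_assoc,
         rule bounded_linear.has_vector_derivative[OF bounded_linear_scaleR_right
           bounded_bilinear.has_vector_derivative[OF bounded_bilinear_matrix_vector_mult
             N2_deriv[OF \<theta>I] has_vector_derivative_at_within[OF vt]]])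
  have t: "transpose (k *\<^sub>R A) = k *\<^sub>R transpose A" for k and A :: "real^2^2"
    by (simp add: transpose_def vec_eq_iff)
  show ?thesis
    unfolding K_adj_def 1 2 3 4 calQ_interior[OF \<theta>] calA1_eq[OF \<theta>I] calA2_eq[OF \<theta>I] t K_coeff_def
      scaleR_matrix_vector_assoc[symmetric]
    by (simp add: scaleR_add_right scaleR_2 flip: scaleR_scaleR)
qed

lemma K_coeff_linear:
  "K_coeff r \<theta> (\<alpha> *\<^sub>R w + \<beta> *\<^sub>R w') (\<alpha> *\<^sub>R y + \<beta> *\<^sub>R y') (\<alpha> *\<^sub>R z + \<beta> *\<^sub>R z')
    = \<alpha> *\<^sub>R K_coeff r \<theta> w y z + \<beta> *\<^sub>R K_coeff r \<theta> w' y' z'"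
proof -
  have "- (k1 *\<^sub>R (\<alpha> *\<^sub>R u1 + \<beta> *\<^sub>R v1)) - k2 *\<^sub>R (\<alpha> *\<^sub>R u2 + \<beta> *\<^sub>R v2)
      - k3 *\<^sub>R (\<alpha> *\<^sub>R u3 + \<beta> *\<^sub>R v3) - k4 *\<^sub>R (\<alpha> *\<^sub>R u4 + \<beta> *\<^sub>R v4)
      + k4 *\<^sub>R (\<alpha> *\<^sub>R u5 + \<beta> *\<^sub>R v5)
    = \<alpha> *\<^sub>R (- (k1 *\<^sub>R u1) - k2 *\<^sub>R u2 - k3 *\<^sub>R u3 - k4 *\<^sub>R u4 + k4 *\<^sub>R u5)
      + \<beta> *\<^sub>R (- (k1 *\<^sub>R v1) - k2 *\<^sub>R v2 - k3 *\<^sub>R v3 - k4 *\<^sub>R v4 + k4 *\<^sub>R v5)"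
    for k1 k2 k3 k4 :: real and u1 u2 u3 u4 u5 v1 v2 v3 v4 v5 :: "real^2"
    by (simp add: scaleR_add_right scaleR_diff_right mult.commute)
  then show ?thesis
    unfolding K_coeff_def matrix_vector_right_distrib matrix_vector_mult_scaleR .
qed

abbreviation (input) "rect r0 r1 \<equiv> cbox (r0, lo) (r1, hi)"

definition admissible :: "real \<Rightarrow> real \<Rightarrow> (real \<times> real \<Rightarrow> real^2) \<Rightarrow> bool" where
  "admissible r0 r1 v \<longleftrightarrow> C1_on (rect r0 r1) v \<and> (\<forall>s. \<forall>x\<in>edge D r0 r1 s. M_adj D v s x = 0)"

lemma K_adj_lincomb:
  assumes v: "C1_on (rect r0 r1) v" and w: "C1_on (rect r0 r1) w"
    and x: "x \<in> Omega1 D r0 r1"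
  shows "K_adj D (\<lambda>x. \<alpha> *\<^sub>R v x + \<beta> *\<^sub>R w x) x = \<alpha> *\<^sub>R K_adj D v x + \<beta> *\<^sub>R K_adj D w x"
proof -
  obtain r \<theta> where x_eq: "x = (r, \<theta>)" by (cases x)
  have \<theta>: "\<theta> \<in> {lo<..<hi}" using x by (simp add: x_eq Omega1_def)
  have "x \<in> interior (rect r0 r1)" using x by (simp add: Omega1_eq_box interior_cbox)
  note at = at_within_interior[OF this]
  have xc: "x \<in> rect r0 r1" using x box_subset_cbox by (auto simp: Omega1_eq_box)
  obtain L where L: "(v has_derivative L) (at (r, \<theta>))"
    using C1_onE[OF v] xc at unfolding x_eq by metis
  obtain L' where L': "(w has_derivative L') (at (r, \<theta>))"
    using C1_onE[OF w] xc at unfolding x_eq by metis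
  have "((\<lambda>x. \<alpha> *\<^sub>R v x + \<beta> *\<^sub>R w x) has_derivative (\<lambda>h. \<alpha> *\<^sub>R L h + \<beta> *\<^sub>R L' h)) (at (r, \<theta>))"
    by (intro derivative_intros L L')
  from K_adj_interior[OF \<theta> this] show ?thesis
    unfolding x_eq K_adj_interior[OF \<theta> L] K_adj_interior[OF \<theta> L'] K_coeff_linear .
qed

lemma admissible_lincomb:
  assumes "admissible r0 r1 v" "admissible r0 r1 w"
  shows "admissible r0 r1 (\<lambda>x. \<alpha> *\<^sub>R v x + \<beta> *\<^sub>R w x)"
proof -
  have "M_adj D (\<lambda>x. \<alpha> *\<^sub>R v x + \<beta> *\<^sub>R w x) s x = \<alpha> *\<^sub>R M_adj D v s x + \<beta> *\<^sub>R M_adj D w s x" for s x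
    by (simp add: M_adj_def matrix_vector_right_distrib matrix_vector_mult_scaleR scaleR_add_right)
  then show ?thesis using assms by (simp add: admissible_def C1_on_lincomb)
qed

lemma admissible_zero: "admissible r0 r1 (\<lambda>x. 0)"
  unfolding admissible_def C1_on_def M_adj_def
  by (intro conjI exI[of _ "\<lambda>x. 0"]) (auto simp: zero_blinfun.rep_eq)

lemma N_symmetric:
  "(N1 \<theta> *v w) \<bullet> z = (N1 \<theta> *v z) \<bullet> w" "(N2 \<theta> *v w) \<bullet> z = (N2 \<theta> *v z) \<bullet> w"
  unfolding N1_def N2_def by (rule mat2_symmetric_inner)+

text \<open>
  The outer normal has opposite directions on opposite sides, whence the alternating signs.
\<close>

lemma boundary_signs:
  assumes r: "0 < r0" "r0 < r1" and v: "admissible r0 r1 v"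
  shows "\<theta> \<in> {lo<..<hi} \<Longrightarrow> (N1 \<theta> *v v (r0, \<theta>)) \<bullet> v (r0, \<theta>) \<ge> 0"
    and "\<theta> \<in> {lo<..<hi} \<Longrightarrow> (N1 \<theta> *v v (r1, \<theta>)) \<bullet> v (r1, \<theta>) \<le> 0"
    and "r \<in> {r0<..<r1} \<Longrightarrow> (N2 lo *v v (r, lo)) \<bullet> v (r, lo) \<ge> 0"
    and "r \<in> {r0<..<r1} \<Longrightarrow> (N2 hi *v v (r, hi)) \<bullet> v (r, hi) \<le> 0"
proof -
  have diss: "(calB D s (r, \<theta>) *v v (r, \<theta>)) \<bullet> v (r, \<theta>) \<le> 0"
    if "(r, \<theta>) \<in> edge D r0 r1 s" "\<theta> \<in> {lo..hi}" "r > 0" for r \<theta> s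
    using v that by (intro boundary_dissipative) (auto simp: admissible_def)
  note simps = calB_def calA1_eq[OF in_angles] calA2_eq[OF in_angles] minus_matrix_vector_mult
    scaleR_matrix_vector_assoc[symmetric] zero_le_mult_iff mult_le_0_iff
  show "(N1 \<theta> *v v (r0, \<theta>)) \<bullet> v (r0, \<theta>) \<ge> 0" if "\<theta> \<in> {lo<..<hi}"
    using diss[of r0 \<theta> R_inner] that r by (auto simp: simps)
  show "(N1 \<theta> *v v (r1, \<theta>)) \<bullet> v (r1, \<theta>) \<le> 0" if "\<theta> \<in> {lo<..<hi}"
    using diss[of r1 \<theta> R_outer] that r by (auto simp: simps)
  show "(N2 lo *v v (r, lo)) \<bullet> v (r, lo) \<ge> 0" if "r \<in> {r0<..<r1}"
    using diss[of r lo Theta_lower] that r lo_less_hi by (auto simp: simps)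
  show "(N2 hi *v v (r, hi)) \<bullet> v (r, hi) \<le> 0" if "r \<in> {r0<..<r1}"
    using diss[of r hi Theta_upper] that r lo_less_hi by (auto simp: simps)
qed

lemma continuous_on_rect_compose:
  assumes "continuous_on I g"
  shows "continuous_on (rect r0 r1) (\<lambda>x. g (snd x))"
  by (rule continuous_on_compose2[OF assms])
     (use lo_ge in \<open>auto intro!: continuous_intros simp: cbox_Pair_eq\<close>)

lemmas continuous_on_matrix_vector =
  bounded_bilinear.continuous_on[OF bounded_bilinear_matrix_vector_mult]

lemma K_adj_square_integrable:
  assumes v: "C1_on (rect r0 r1) v"
  shows "square_integrable (lebesgue_on (Omega1 D r0 r1)) (K_adj D v)"
proof -
  obtain v' where v'_cont: "continuous_on (rect r0 r1) v'"
    and v': "\<And>x. x \<in> rect r0 r1 \<Longrightarrow> (v has_derivative blinfun_apply (v' x)) (at x within rect r0 r1)"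
    using C1_onE[OF v] by metis
  note v_cont = C1_on_continuous[OF v]
  have "continuous_on (rect r0 r1) (\<lambda>x. K_coeff (fst x) (snd x) (v x) (v' x (1, 0)) (v' x (0, 1)))"
    unfolding K_coeff_def
    by (intro continuous_intros continuous_on_matrix_vector continuous_on_rect_compose N_continuous
        v_cont v'_cont bounded_linear.continuous_on[OF bounded_linear_transpose])
  from continuous_square_integrable_on_box[OF this]
  show ?thesis
    unfolding Omega1_eq_box[symmetric]
  proof (rule square_integrable_cong)
    fix x assume "x \<in> space (lebesgue_on (Omega1 D r0 r1))"
    then have x: "x \<in> Omega1 D r0 r1" by (simp add: space_restrict_space)
    obtain r \<theta> where x_eq: "x = (r, \<theta>)" by (cases x)
    have \<theta>: "\<theta> \<in> {lo<..<hi}" using x by (simp add: x_eq Omega1_def)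
    have "x \<in> interior (rect r0 r1)" using x by (simp add: Omega1_eq_box interior_cbox)
    note at = at_within_interior[OF this]
    have "x \<in> rect r0 r1" using x box_subset_cbox by (auto simp: Omega1_eq_box)
    from v'[OF this] show "K_coeff (fst x) (snd x) (v x) (v' x (1, 0)) (v' x (0, 1)) = K_adj D v x"
      unfolding at unfolding x_eq fst_conv snd_conv by (rule K_adj_interior[OF \<theta>, symmetric])
  qed
qed

section \<open>Energy estimate and weak solutions\<close>

text \<open>
  The integrand \<open>K_adj v \<bullet> v\<close> equals \<open>E - g1 - g2\<close>, where \<open>g1\<close> and \<open>g2\<close> are the radial and the
  angular derivative of \<open>\<A>\<^sup>(\<^sup>1\<^sup>) v \<bullet> v\<close> and \<open>\<A>\<^sup>(\<^sup>2\<^sup>) v \<bullet> v\<close> and \<open>E = \<Q> v \<bullet> v\<close>. By the signs at the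
  boundary the integrals of \<open>- g1\<close> and \<open>- g2\<close> are nonnegative, and \<open>E\<close> is coercive.
\<close>

lemma energy_estimate:
  assumes r: "0 < r0" "r0 < r1"
  shows "\<exists>c>0. \<forall>v. admissible r0 r1 v \<longrightarrow>
    c * (LINT x|lebesgue_on (Omega1 D r0 r1). (norm (v x))\<^sup>2)
      \<le> (LINT x|lebesgue_on (Omega1 D r0 r1). K_adj D v x \<bullet> v x)"
proof -
  obtain c where c: "c > 0" "\<And>\<theta> w. \<theta> \<in> I \<Longrightarrow> c * (norm w)\<^sup>2 \<le> (NQ \<theta> *v w) \<bullet> w"
    using NQ_coercive by blast
  have "(r0\<^sup>2 * c) * (LINT x|lebesgue_on (Omega1 D r0 r1). (norm (v x))\<^sup>2)
      \<le> (LINT x|lebesgue_on (Omega1 D r0 r1). K_adj D v x \<bullet> v x)" if adm: "admissible r0 r1 v" for v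
  proof -
    let ?R = "rect r0 r1"
    have v: "C1_on ?R v" using adm by (simp add: admissible_def)
    obtain v' where v'_cont: "continuous_on ?R v'"
      and v': "\<And>x. x \<in> ?R \<Longrightarrow> (v has_derivative blinfun_apply (v' x)) (at x within ?R)"
      using C1_onE[OF v] by metis
    note v_cont = C1_on_continuous[OF v]
    define vr vt where "vr x = v' x (1, 0)" and "vt x = v' x (0, 1)" for x
    define G1 where "G1 x = fst x ^ 3 * ((N1 (snd x) *v v x) \<bullet> v x)" for x
    define G2 where "G2 x = (fst x)\<^sup>2 * ((N2 (snd x) *v v x) \<bullet> v x)" for x
    define g1 where "g1 x = 3 * (fst x)\<^sup>2 * ((N1 (snd x) *v v x) \<bullet> v x)
      + 2 * fst x ^ 3 * ((N1 (snd x) *v vr x) \<bullet> v x)" for x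
    define g2 where "g2 x = (fst x)\<^sup>2 * ((dN2 (snd x) *v v x) \<bullet> v x)
      + 2 * (fst x)\<^sup>2 * ((N2 (snd x) *v vt x) \<bullet> v x)" for x
    define E where "E x = (fst x)\<^sup>2 * ((NQ (snd x) *v v x) \<bullet> v x)" for x
    note cont = continuous_intros continuous_on_matrix_vector continuous_on_rect_compose
      N_continuous v_cont v'_cont
    have g1_cont: "continuous_on ?R g1" and g2_cont: "continuous_on ?R g2"
      and E_cont: "continuous_on ?R E"
      unfolding g1_def[abs_def] g2_def[abs_def] E_def[abs_def] vr_def vt_def by (intro cont)+
    have slices: "((\<lambda>s. v (s, \<theta>)) has_vector_derivative vr (r, \<theta>)) (at r within {r0..r1})"
        "((\<lambda>t. v (r, t)) has_vector_derivative vt (r, \<theta>)) (at \<theta> within {lo..hi})"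
      if "r \<in> {r0..r1}" "\<theta> \<in> {lo..hi}" for r \<theta>
    proof -
      have "(v has_derivative blinfun_apply (v' (r, \<theta>))) (at (r, \<theta>) within {r0..r1} \<times> {lo..hi})"
        using v'[of "(r, \<theta>)"] that by (simp add: cbox_Pair_eq)
      from has_vector_derivative_slice_fst[OF this that(2)]
        has_vector_derivative_slice_snd[OF this that(1)]
      show "((\<lambda>s. v (s, \<theta>)) has_vector_derivative vr (r, \<theta>)) (at r within {r0..r1})"
        "((\<lambda>t. v (r, t)) has_vector_derivative vt (r, \<theta>)) (at \<theta> within {lo..hi})"
        by (simp_all add: vr_def vt_def)
    qed
    have "0 \<le> integral ?R (\<lambda>x. - g1 x)"
    proof (rule integral_partial_fst_nonneg[where G="\<lambda>x. - G1 x"])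
      fix r \<theta> assume rt: "r \<in> {r0..r1}" "\<theta> \<in> {lo..hi}"
      have "((\<lambda>s. s ^ 3 * ((N1 \<theta> *v v (s, \<theta>)) \<bullet> v (s, \<theta>))) has_vector_derivative
          r ^ 3 * ((N1 \<theta> *v v (r, \<theta>)) \<bullet> vr (r, \<theta>) + (N1 \<theta> *v vr (r, \<theta>)) \<bullet> v (r, \<theta>))
          + (3 * r\<^sup>2) * ((N1 \<theta> *v v (r, \<theta>)) \<bullet> v (r, \<theta>))) (at r within {r0..r1})"
        using has_vector_derivative_scaleR[OF power_deriv
          bounded_bilinear.has_vector_derivative[OF bounded_bilinear_inner
            bounded_linear.has_vector_derivative[OF matrix_vector_mul_bounded_linear slices(1)[OF rt]]
            slices(1)[OF rt]]]
        by simp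
      also have "r ^ 3 * ((N1 \<theta> *v v (r, \<theta>)) \<bullet> vr (r, \<theta>) + (N1 \<theta> *v vr (r, \<theta>)) \<bullet> v (r, \<theta>))
          + (3 * r\<^sup>2) * ((N1 \<theta> *v v (r, \<theta>)) \<bullet> v (r, \<theta>)) = g1 (r, \<theta>)"
        unfolding N_symmetric(1)[of \<theta> "v (r, \<theta>)" "vr (r, \<theta>)"] by (simp add: g1_def)
      finally show "((\<lambda>s. - G1 (s, \<theta>)) has_vector_derivative - g1 (r, \<theta>)) (at r within {r0..r1})"
        unfolding G1_def fst_conv snd_conv by (rule has_vector_derivative_minus)
    next
      fix \<theta> assume "\<theta> \<in> {lo<..<hi}"
      then have "G1 (r0, \<theta>) \<ge> 0" "G1 (r1, \<theta>) \<le> 0"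
        using boundary_signs[OF r adm] r by (simp_all add: G1_def mult_nonneg_nonpos)
      then show "- G1 (r0, \<theta>) \<le> - G1 (r1, \<theta>)" by simp
    qed (use r g1_cont in \<open>auto intro: continuous_intros\<close>)
    moreover have "0 \<le> integral ?R (\<lambda>x. - g2 x)"
    proof (rule integral_partial_snd_nonneg[where G="\<lambda>x. - G2 x"])
      fix r \<theta> assume rt: "r \<in> {r0..r1}" "\<theta> \<in> {lo..hi}"
      have dN: "(N2 has_vector_derivative dN2 \<theta>) (at \<theta> within {lo..hi})"
        by (rule has_vector_derivative_within_subset[OF N2_deriv]) (use rt lo_ge in auto)
      have "((\<lambda>t. r\<^sup>2 * ((N2 t *v v (r, t)) \<bullet> v (r, t))) has_vector_derivative
          r\<^sup>2 * ((N2 \<theta> *v v (r, \<theta>)) \<bullet> vt (r, \<theta>)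
            + (N2 \<theta> *v vt (r, \<theta>) + dN2 \<theta> *v v (r, \<theta>)) \<bullet> v (r, \<theta>))) (at \<theta> within {lo..hi})"
        using bounded_linear.has_vector_derivative[OF bounded_linear_mult_right
          bounded_bilinear.has_vector_derivative[OF bounded_bilinear_inner
            bounded_bilinear.has_vector_derivative[OF bounded_bilinear_matrix_vector_mult dN
              slices(2)[OF rt]] slices(2)[OF rt]]] .
      also have "r\<^sup>2 * ((N2 \<theta> *v v (r, \<theta>)) \<bullet> vt (r, \<theta>)
            + (N2 \<theta> *v vt (r, \<theta>) + dN2 \<theta> *v v (r, \<theta>)) \<bullet> v (r, \<theta>)) = g2 (r, \<theta>)"
        unfolding N_symmetric(2)[of \<theta> "v (r, \<theta>)" "vt (r, \<theta>)"]
        by (simp add: g2_def inner_add_left distrib_left)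
      finally show "((\<lambda>t. - G2 (r, t)) has_vector_derivative - g2 (r, \<theta>)) (at \<theta> within {lo..hi})"
        unfolding G2_def fst_conv snd_conv by (rule has_vector_derivative_minus)
    next
      fix r assume "r \<in> {r0<..<r1}"
      then have "G2 (r, lo) \<ge> 0" "G2 (r, hi) \<le> 0"
        using boundary_signs[OF r adm] by (simp_all add: G2_def mult_nonneg_nonpos)
      then show "- G2 (r, lo) \<le> - G2 (r, hi)" by simp
    qed (use lo_less_hi g2_cont in \<open>auto intro: continuous_intros\<close>)
    moreover have "(LINT x|lebesgue_on (Omega1 D r0 r1). K_adj D v x \<bullet> v x)
        = integral ?R (\<lambda>x. E x + - g1 x + - g2 x)"
    proof -
      have "(LINT x|lebesgue_on (Omega1 D r0 r1). K_adj D v x \<bullet> v x)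
          = (LINT x|lebesgue_on (Omega1 D r0 r1). E x + - g1 x + - g2 x)"
      proof (rule Bochner_Integration.integral_cong[OF refl])
        fix x assume "x \<in> space (lebesgue_on (Omega1 D r0 r1))"
        then have x: "x \<in> Omega1 D r0 r1" by (simp add: space_restrict_space)
        obtain r \<theta> where x_eq: "x = (r, \<theta>)" by (cases x)
        have \<theta>: "\<theta> \<in> {lo<..<hi}" using x by (simp add: x_eq Omega1_def)
        have "x \<in> interior ?R" using x by (simp add: Omega1_eq_box interior_cbox)
        note at = at_within_interior[OF this]
        have "x \<in> ?R" using x box_subset_cbox by (auto simp: Omega1_eq_box)
        from v'[OF this] have "K_adj D v x = K_coeff r \<theta> (v x) (vr x) (vt x)"
          unfolding at unfolding x_eq vr_def vt_def by (rule K_adj_interior[OF \<theta>])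
        then show "K_adj D v x \<bullet> v x = E x + - g1 x + - g2 x"
          by (simp add: K_coeff_def inner_add_left inner_diff_left transpose_mult_inner_self
              E_def g1_def g2_def x_eq del: transpose_matrix_vector)
      qed
      also have "\<dots> = integral ?R (\<lambda>x. E x + - g1 x + - g2 x)"
        unfolding Omega1_eq_box
        by (intro integral_box_eq_integral_cbox continuous_intros E_cont g1_cont g2_cont)
      finally show ?thesis .
    qed
    moreover have "integral ?R (\<lambda>x. E x + - g1 x + - g2 x)
        = integral ?R E + integral ?R (\<lambda>x. - g1 x) + integral ?R (\<lambda>x. - g2 x)"
      using E_cont g1_cont g2_cont
      by (simp add: Henstock_Kurzweil_Integration.integral_diff integrable_continuous
          integrable_diff)
    moreover have "(r0\<^sup>2 * c) * (LINT x|lebesgue_on (Omega1 D r0 r1). (norm (v x))\<^sup>2)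
        \<le> integral ?R E"
    proof -
      have n_cont: "continuous_on ?R (\<lambda>x. (r0\<^sup>2 * c) * (norm (v x))\<^sup>2)"
        by (intro continuous_intros v_cont)
      have "(r0\<^sup>2 * c) * (LINT x|lebesgue_on (Omega1 D r0 r1). (norm (v x))\<^sup>2)
          = integral ?R (\<lambda>x. (r0\<^sup>2 * c) * (norm (v x))\<^sup>2)"
        unfolding Omega1_eq_box integral_box_eq_integral_cbox[OF n_cont, symmetric] by simp
      also have "\<dots> \<le> integral ?R E"
      proof (rule integral_le)
        fix x assume "x \<in> ?R"
        then have x: "fst x \<in> {r0..r1}" "snd x \<in> I"
          using in_angles by (auto simp: cbox_Pair_eq)
        have "r0\<^sup>2 * (c * (norm (v x))\<^sup>2) \<le> (fst x)\<^sup>2 * ((NQ (snd x) *v v x) \<bullet> v x)"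
          using x r c by (intro mult_mono power_mono) auto
        then show "(r0\<^sup>2 * c) * (norm (v x))\<^sup>2 \<le> E x" by (simp add: E_def mult.assoc)
      qed (intro integrable_continuous n_cont E_cont)+
      finally show ?thesis .
    qed
    ultimately show ?thesis by linarith
  qed
  moreover have "r0\<^sup>2 * c > 0" using r c by simp
  ultimately show ?thesis by blast
qed

lemma L2_on_iff_square_integrable: "L2_on S f \<longleftrightarrow> square_integrable (lebesgue_on S) f"
  by (simp add: L2_on_def square_integrable_def)

lemma weak_solution_exists:
  assumes r: "0 < r0" "r0 < r1" and f: "L2_on (Omega1 D r0 r1) f"
  shows "\<exists>u. weak_solution D r0 r1 f u"
proof -
  let ?M = "lebesgue_on (Omega1 D r0 r1)"
  let ?V = "{v. admissible r0 r1 v}"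
  define L where "L v = (LINT x|?M. f x \<bullet> v x)" for v
  have f: "square_integrable ?M f" using f by (simp add: L2_on_iff_square_integrable)
  have C1: "C1_on (rect r0 r1) v" if "v \<in> ?V" for v
    using that by (simp add: admissible_def)
  have v: "square_integrable ?M v" if "v \<in> ?V" for v
    unfolding Omega1_eq_box
    by (rule continuous_square_integrable_on_box[OF C1_on_continuous[OF C1[OF that]]])
  have K: "square_integrable ?M (K_adj D v)" if "v \<in> ?V" for v
    by (rule K_adj_square_integrable[OF C1[OF that]])
  obtain c where c: "c > 0" and energy: "\<And>v. v \<in> ?V \<Longrightarrow>
      c * (LINT x|?M. (norm (v x))\<^sup>2) \<le> (LINT x|?M. K_adj D v x \<bullet> v x)"
    using energy_estimate[OF r] by auto
  have "\<exists>u. square_integrable ?M u \<and> (\<forall>v\<in>?V. (LINT x|?M. K_adj D v x \<bullet> u x) = L v)"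
  proof (rule Riesz_L2[where C="(LINT x|?M. (norm (f x))\<^sup>2) / c\<^sup>2"])
    show "?V \<noteq> {}" using admissible_zero by auto
    show "0 \<le> (LINT x|?M. (norm (f x))\<^sup>2) / c\<^sup>2" by simp
    fix v assume vV: "v \<in> ?V"
    define n k where "n = (LINT x|?M. (norm (v x))\<^sup>2)" and "k = (LINT x|?M. (norm (K_adj D v x))\<^sup>2)"
    have nn: "n \<ge> 0" "k \<ge> 0" by (simp_all add: n_def k_def)
    \<comment> \<open>From \<open>c \<parallel>v\<parallel>\<^sup>2 \<le> \<langle>K_adj v, v\<rangle> \<le> \<parallel>K_adj v\<parallel> \<parallel>v\<parallel>\<close>, written without square roots.\<close>
    have "(c * n)\<^sup>2 \<le> (LINT x|?M. K_adj D v x \<bullet> v x)\<^sup>2"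
      using energy[OF vV] c nn by (intro power_mono) (auto simp: n_def)
    also have "\<dots> \<le> k * n"
      unfolding n_def k_def by (rule integral_Cauchy_Schwarz[OF K[OF vV] v[OF vV]])
    finally have "(c\<^sup>2 * n) * n \<le> k * n" by (simp add: power2_eq_square ac_simps)
    then have "c\<^sup>2 * n \<le> k" using nn by (cases "n = 0") (auto simp: mult_le_cancel_right)
    then have n_le: "n \<le> k / c\<^sup>2" using c by (simp add: field_simps)
    have "(L v)\<^sup>2 \<le> (LINT x|?M. (norm (f x))\<^sup>2) * n"
      unfolding L_def n_def by (rule integral_Cauchy_Schwarz[OF f v[OF vV]])
    also have "\<dots> \<le> (LINT x|?M. (norm (f x))\<^sup>2) * (k / c\<^sup>2)"
      by (rule mult_left_mono[OF n_le]) simp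
    finally show "(L v)\<^sup>2 \<le> (LINT x|?M. (norm (f x))\<^sup>2) / c\<^sup>2 * (LINT x|?M. (norm (K_adj D v x))\<^sup>2)"
      by (simp add: k_def)
  next
    fix v w and \<alpha> \<beta> :: real
    assume vw: "v \<in> ?V" "w \<in> ?V"
    let ?z = "\<lambda>x. \<alpha> *\<^sub>R v x + \<beta> *\<^sub>R w x"
    have "?z \<in> ?V" using vw by (simp add: admissible_lincomb)
    moreover have "\<forall>x\<in>space ?M. K_adj D ?z x = \<alpha> *\<^sub>R K_adj D v x + \<beta> *\<^sub>R K_adj D w x"
      using K_adj_lincomb[OF C1[OF vw(1)] C1[OF vw(2)]] by (simp add: space_restrict_space)
    moreover have "L ?z = \<alpha> * L v + \<beta> * L w"
      using square_integrable_integrable_inner[OF f v[OF vw(1)]]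
        square_integrable_integrable_inner[OF f v[OF vw(2)]]
      by (simp add: L_def inner_add_right)
    ultimately show "\<exists>z\<in>?V. (\<forall>x\<in>space ?M. K_adj D z x = \<alpha> *\<^sub>R K_adj D v x + \<beta> *\<^sub>R K_adj D w x)
        \<and> L z = \<alpha> * L v + \<beta> * L w" by blast
  qed (rule K)
  then show ?thesis
    unfolding weak_solution_def L2_on_iff_square_integrable closure_Omega1[OF r(2)]
    by (auto simp: admissible_def L_def)
qed

end

theorem theorem3p6:
  fixes D :: flow and r0 r1 :: real and f :: "real \<times> real \<Rightarrow> real^2"
  assumes "background_flow D" and "multiplier_choice D"
    and "0 < r0" and "r0 < r1"
    and "L2_on (Omega1 D r0 r1) f"
  shows "\<exists>u. weak_solution D r0 r1 f u"
proof -
  interpret conical_flow D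
    using assms by unfold_locales
  show ?thesis by (rule weak_solution_exists) (use assms in auto)
qed

end
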